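(* Let $K$ be a field of characteristic $0$ and let $S$ be a commutative cancellative torsion-free reduced monoid, written additively. Let $0\neq s\in S$ and let $\Phi\in K[X]$ be a (nonempty finite) product of cyclotomic polynomials over $K$. If $S$ is a finite factorization monoid (FFM), then $\Phi(X^s)$ satisfies the FF-property in the monoid algebra $K[S]$.
   Context: The additive monoid $S$ is torsion-free if $ns=nt$ with $n$ a positive integer and $s,t\in S$ implies $s=t$; it is reduced if its only invertible element is $0$. The monoid algebra $K[S]$ is the ring of all finite sums $\sum_i a_iX^{s_i}$ with $a_i\in K$, $s_i\in S$, with multiplication determined by $X^sX^t=X^{s+t}$; it is an integral domain when $S$ is cancellative and torsion-free. For $f(X)=\sum_k a_kX^k\in K[X]$ and $s\in S$, $f(X^s)$ denotes the element $\sum_k a_kX^{ks}$ of $K[S]$. In $S$, $s$ divides $t$ if $t=s+r$ for some $r\in S$; elements are associate if they differ by a unit of $S$; an atom is a nonunit that is not a sum of two nonunits; $S$ is atomic if every nonunit is a finite sum of atoms. $S$ is a finite factorization monoid (FFM) if it is atomic and each nonunit has only finitely many non-associate irreducible divisors; equivalently, each nonunit of $S$ has only finitely many non-associate divisors in $S$. A cyclotomic polynomial over a field $K$ is a monic polynomial in $K[X]$, irreducible over $K$, whose zeros (in an algebraic closure of $K$) are roots of unity; i.e. a monic irreducible divisor in $K[X]$ of $X^\delta-1$ for some positive integer $\delta$. A nonzero nonunit element of an integral domain $D$ satisfies the FF-property in $D$ if it has only a finite number of factorizations (as products of nonunits of $D$) up to order and associates; equivalently, it has only finitely many non-associate divisors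 in $D$. *)

theory Defs
  imports
    "HOL-Library.Poly_Mapping"
    "HOL-Library.Multiset"
    "HOL-Computational_Algebra.Polynomial"
    "HOL-Computational_Algebra.Factorial_Ring"
    "HOL-Algebra.Algebraic_Closure_Type"
begin

text \<open>
  A monoid is a type of class \<^class>\<open>comm_monoid_add\<close>, and the monoid algebra of
  a monoid \<open>'s\<close> over a field \<open>'k\<close> is the commutative ring \<open>'s \<Rightarrow>\<^sub>0 'k\<close> of finitely supported
  functions with the convolution product; \<open>Poly_Mapping.single s a\<close> is the monomial with
  coefficient \<open>a\<close> and exponent \<open>s\<close>. Cancellativity is an explicit predicate, because the class
  \<^class>\<open>cancel_comm_monoid_add\<close> would also impose a total subtraction on the monoid.
\<close>

definition nmult :: "nat \<Rightarrow> 's::comm_monoid_add \<Rightarrow> 's"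
  where "nmult n s = (\<Sum>i<n. s)"

definition madd_unit :: "'s::comm_monoid_add \<Rightarrow> bool"
  where "madd_unit u \<longleftrightarrow> (\<exists>v. u + v = 0)"

definition madd_dvd :: "'s::comm_monoid_add \<Rightarrow> 's \<Rightarrow> bool"
  where "madd_dvd s t \<longleftrightarrow> (\<exists>r. t = s + r)"

definition madd_assoc :: "'s::comm_monoid_add \<Rightarrow> 's \<Rightarrow> bool"
  where "madd_assoc s t \<longleftrightarrow> (\<exists>u. madd_unit u \<and> t = s + u)"

definition madd_atom :: "'s::comm_monoid_add \<Rightarrow> bool"
  where "madd_atom a \<longleftrightarrow> \<not> madd_unit a \<and> (\<forall>b c. a = b + c \<longrightarrow> madd_unit b \<or> madd_unit c)"

definition cancellative_monoid :: "'s::comm_monoid_add itself \<Rightarrow> bool"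
  where "cancellative_monoid _ \<longleftrightarrow> (\<forall>a b c :: 's. a + b = a + c \<longrightarrow> b = c)"

definition torsion_free_monoid :: "'s::comm_monoid_add itself \<Rightarrow> bool"
  where "torsion_free_monoid _ \<longleftrightarrow>
    (\<forall>(n::nat) (s::'s) (t::'s). 0 < n \<longrightarrow> nmult n s = nmult n t \<longrightarrow> s = t)"

definition reduced_monoid :: "'s::comm_monoid_add itself \<Rightarrow> bool"
  where "reduced_monoid _ \<longleftrightarrow> (\<forall>u::'s. madd_unit u \<longrightarrow> u = 0)"

definition atomic_monoid :: "'s::comm_monoid_add itself \<Rightarrow> bool"
  where "atomic_monoid _ \<longleftrightarrow>
    (\<forall>s::'s. \<not> madd_unit s \<longrightarrow> (\<exists>A. (\<forall>a\<in>#A. madd_atom a) \<and> s = sum_mset A))"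

text \<open>``Finitely many non-associate'' means that the set of associate classes is finite.\<close>

definition finite_factorization_monoid :: "'s::comm_monoid_add itself \<Rightarrow> bool"
  where "finite_factorization_monoid _ \<longleftrightarrow>
    atomic_monoid TYPE('s) \<and>
    (\<forall>s::'s. \<not> madd_unit s \<longrightarrow>
       finite ((\<lambda>a. {b. madd_assoc a b}) ` {a. madd_atom a \<and> madd_dvd a s}))"

definition cyclotomic_polynomial :: "'k::field poly \<Rightarrow> bool"
  where "cyclotomic_polynomial p \<longleftrightarrow>
    lead_coeff p = 1 \<and> Factorial_Ring.irreducible p \<and>
    (\<forall>z :: 'k alg_closure. poly (map_poly to_ac p) z = 0 \<longrightarrow> (\<exists>n>0. z ^ n = 1))"

text \<open>The element $f(X^s)$ of the monoid algebra.\<close>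

definition poly_subst_monomial :: "'k::comm_ring_1 poly \<Rightarrow> 's::comm_monoid_add \<Rightarrow> ('s \<Rightarrow>\<^sub>0 'k)"
  where "poly_subst_monomial f s =
    (\<Sum>k\<le>Polynomial.degree f. Poly_Mapping.single (nmult k s) (Polynomial.coeff f k))"

definition ring_assoc :: "'a::comm_ring_1 \<Rightarrow> 'a \<Rightarrow> bool"
  where "ring_assoc a b \<longleftrightarrow> (\<exists>u. u dvd 1 \<and> b = a * u)"

definition nonunit_factorizations :: "'a::comm_ring_1 \<Rightarrow> 'a multiset set"
  where "nonunit_factorizations x = {A. (\<forall>a\<in>#A. \<not> a dvd 1) \<and> prod_mset A = x}"

text \<open>
  Replacing every factor by its associate class identifies exactly those factorizations that
  agree up to order and associates.
\<close>

definition FF_property :: "'a::comm_ring_1 \<Rightarrow> bool"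
  where "FF_property x \<longleftrightarrow>
    x \<noteq> 0 \<and> \<not> x dvd 1 \<and>
    finite ((\<lambda>A. image_mset (\<lambda>a. {b. ring_assoc a b}) A) ` nonunit_factorizations x)"

end

theory Submission
  imports
    Defs
    "HOL-Computational_Algebra.Polynomial_Factorial"
    "HOL-Computational_Algebra.Field_as_Ring"
    "HOL-Computational_Algebra.Fundamental_Theorem_Algebra"
begin

text \<open>
  Let \<open>h = \<Phi>(X\<^sup>s)\<close> and \<open>h = f g\<close>. Since \<open>S\<close> is reduced, \<open>0\<close> lies in the support of
  \<open>f\<close> and of \<open>g\<close>, and a translation invariant total preorder on \<open>S\<close> that identifies
  exactly the elements commensurable modulo \<open>s\<close> shows that every \<open>t\<close> in these supports satisfies
  \<open>n t = k s\<close> for some \<open>n > 0\<close>. Dilating exponents by a common \<open>n\<close> turns \<open>f\<close> and \<open>g\<close> into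
  ordinary polynomials \<open>F\<close>, \<open>G\<close> with \<open>F G = \<Phi>(Y\<^sup>n)\<close>. All roots of \<open>F\<close> are roots of unity, and
  inverting roots of unity preserves the vanishing of rational expressions in them, so the support of
  \<open>F\<close> is symmetric. Hence every \<open>t\<close> in the support of \<open>f\<close> divides the top exponent of \<open>f\<close>, which
  divides \<open>deg(\<Phi>) s\<close>. In an FFM that element has finitely many divisors, so one \<open>n\<close> serves all
  divisors \<open>f\<close> of \<open>h\<close>, and \<open>f\<close> is determined up to a scalar by a monic divisor of \<open>\<Phi>(Y\<^sup>n)\<close>.
\<close>

section \<open>Polynomials whose roots are roots of unity\<close>

lemma map_poly_add_hom:
  assumes "f 0 = 0" "\<And>a b. f (a + b) = f a + f b"
  shows "map_poly f (p + q) = map_poly f p + map_poly f q"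
  by (intro poly_eqI) (simp add: coeff_map_poly assms)

lemma map_poly_mult_hom:
  fixes f :: "'a::comm_ring_1 \<Rightarrow> 'b::comm_ring_1"
  assumes f: "f 0 = 0" "\<And>a b. f (a + b) = f a + f b" "\<And>a b. f (a * b) = f a * f b"
  shows "map_poly f (p * q) = map_poly f p * map_poly f q"
proof (induction p)
  case (pCons a p)
  show ?case
    by (simp add: map_poly_add_hom map_poly_pCons map_poly_smult f pCons.IH)
qed simp

text \<open>Induction over the prime factors of \<open>n\<close>: if the new prime \<open>p\<close>
  already divides \<open>n\<close>, every \<open>p\<close>-th root of the old root of unity has
  order \<open>p * n\<close>; otherwise the old one is multiplied by an element of order
  \<open>p\<close>.\<close>

lemma exists_primitive_root_of_unity:
  assumes "n > 0"
  shows "\<exists>\<zeta>::'a::{alg_closed_field,field_char_0}. \<forall>k. \<zeta> ^ k = 1 \<longleftrightarrow> n dvd k"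
  using assms
proof (induction n rule: prime_divisors_induct)
  case zero
  then show ?case by simp
next
  case (unit n)
  then show ?case by (intro exI[of _ 1]) auto
next
  case (factor p n)
  have p: "p > 1" and n: "n > 0"
    using factor prime_gt_1_nat by (auto intro: Nat.gr0I)
  from factor.IH[OF n] obtain \<zeta> :: 'a where \<zeta>: "\<And>k. \<zeta> ^ k = 1 \<longleftrightarrow> n dvd k" by blast
  show ?case
  proof (cases "p dvd n")
    case True
    from p obtain \<xi> :: 'a where \<xi>: "\<xi> ^ p = \<zeta>" using nth_root_exists[of p \<zeta>] by auto
    have "\<xi> ^ k = 1 \<longleftrightarrow> p * n dvd k" for k
    proof
      assume "\<xi> ^ k = 1"
      then have "\<zeta> ^ k = 1"
        by (metis \<xi> mult.commute power_mult power_one)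
      then have "p dvd k" using \<zeta> True dvd_trans by blast
      then obtain j where j: "k = p * j" by blast
      then have "\<zeta> ^ j = 1" using \<open>\<xi> ^ k = 1\<close> \<xi> by (simp add: power_mult)
      then show "p * n dvd k" using j \<zeta> by simp
    next
      assume "p * n dvd k"
      then obtain j where "k = p * (n * j)" by (metis dvdE mult.assoc)
      moreover have "\<zeta> ^ (n * j) = 1" using \<zeta> by simp
      ultimately show "\<xi> ^ k = 1" using \<xi> by (simp add: power_mult)
    qed
    then show ?thesis by blast
  next
    case False
    \<comment> \<open>A root \<open>y\<close> of \<open>1 + X + ... + X^(p-1)\<close> has order
      \<open>p\<close>: it is a root of \<open>X^p - 1\<close>, and it is not 1 because the value at
      1 is \<open>p\<close>, which is nonzero in characteristic 0.\<close>
    let ?q = "(\<Sum>i<p. monom 1 i) :: 'a poly"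
    have cq: "coeff ?q j = (if j < p then 1 else 0)" for j
      by (simp add: coeff_sum)
    have "degree ?q \<ge> p - 1" using p by (intro le_degree) (simp add: cq)
    then have "degree ?q > 0" using p by simp
    then obtain y where "poly ?q y = 0" using alg_closed_imp_poly_has_root by blast
    then have y0: "(\<Sum>i<p. y ^ i) = 0" by (simp add: poly_sum poly_monom)
    have y1: "y \<noteq> 1" using y0 p by auto
    have yp: "y ^ p = 1" using y0 power_diff_1_eq[of y p] by simp
    have yk: "p dvd k" if "y ^ k = 1" for k
    proof (rule ccontr)
      assume "\<not> p dvd k"
      then have "coprime k p" using factor(1) by (metis prime_imp_coprime coprime_commute)
      moreover have "k \<noteq> 0" using \<open>\<not> p dvd k\<close> by (metis dvd_0_right)
      ultimately obtain a b where "k * a = p * b + 1"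
        using bezout_nat[of k p] by (auto simp: coprime_iff_gcd_eq_1)
      then have "y ^ (k * a) = y" using yp by (simp add: power_add power_mult)
      then show False using that y1 by (simp add: power_mult)
    qed
    have "(\<zeta> * y) ^ k = 1 \<longleftrightarrow> p * n dvd k" for k
    proof
      assume 1: "(\<zeta> * y) ^ k = 1"
      \<comment> \<open>Raising to the \<open>p\<close>-th power removes \<open>y\<close>, and
        \<open>p\<close> is coprime to \<open>n\<close> here, so \<open>n dvd k\<close> follows
        first and \<open>p dvd k\<close> afterwards.\<close>
      have "(\<zeta> * y) ^ (k * p) = \<zeta> ^ (p * k) * (y ^ p) ^ k"
        by (simp add: power_mult_distrib mult.commute flip: power_mult)
      then have "\<zeta> ^ (p * k) = 1" using 1 yp by (simp add: power_mult)
      then have "n dvd k" using \<zeta> False factor(1)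
        by (metis coprime_commute coprime_dvd_mult_right_iff prime_imp_coprime)
      then have "\<zeta> ^ k = 1" using \<zeta> by simp
      then have "p dvd k" using 1 yk by (simp add: power_mult_distrib)
      then show "p * n dvd k" using \<open>n dvd k\<close> False factor(1)
        by (simp add: divides_mult prime_imp_coprime)
    next
      assume "p * n dvd k"
      then have "n dvd k" "p dvd k" using dvd_mult_left dvd_mult_right by blast+
      then show "(\<zeta> * y) ^ k = 1" using \<zeta>[of k] yp by (auto simp: power_mult_distrib power_mult elim!: dvdE)
    qed
    then show ?thesis by blast
  qed
qed

text \<open>Counting: the first \<open>n\<close> powers of \<open>\<zeta>\<close> are distinct roots
  of \<open>X^n - 1\<close>, which has at most \<open>n\<close> roots.\<close>

lemma root_of_unity_is_power:
  fixes \<zeta> z :: "'a::{field}"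
  assumes n: "n > 0" and \<zeta>: "\<And>k. \<zeta> ^ k = 1 \<longleftrightarrow> n dvd k" and z: "z ^ n = 1"
  obtains k where "k < n" "z = \<zeta> ^ k"
proof -
  have nz: "\<zeta> \<noteq> 0" using \<zeta>[of n] n by (auto simp: power_0_left)
  have inj: "inj_on (\<lambda>k. \<zeta> ^ k) {..<n}"
  proof (rule linorder_inj_onI)
    fix i j :: nat assume ij: "i < j" "i \<in> {..<n}" "j \<in> {..<n}"
    then have "\<zeta> ^ j = \<zeta> ^ i * \<zeta> ^ (j - i)" by (simp flip: power_add)
    moreover have "\<zeta> ^ (j - i) \<noteq> 1" using \<zeta>[of "j - i"] ij by (auto dest: dvd_imp_le)
    ultimately show "\<zeta> ^ i \<noteq> \<zeta> ^ j" using nz by auto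
  qed auto
  let ?p = "monom 1 n - 1 :: 'a poly"
  have deg: "degree ?p \<le> n"
    by (intro degree_le) (auto simp: coeff_1)
  have "coeff ?p n = 1" using n by (simp add: coeff_1)
  then have p0: "?p \<noteq> 0" by (metis coeff_0 zero_neq_one)
  have "card {x. poly ?p x = 0} \<le> n" using card_poly_roots_bound[OF p0] deg by linarith
  moreover have sub: "(\<lambda>k. \<zeta> ^ k) ` {..<n} \<subseteq> {x. poly ?p x = 0}"
    using \<zeta> by (auto simp: poly_monom simp flip: power_mult)
  moreover have "card ((\<lambda>k. \<zeta> ^ k) ` {..<n}) = n" using inj by (simp add: card_image)
  ultimately have "(\<lambda>k. \<zeta> ^ k) ` {..<n} = {x. poly ?p x = 0}"
    using poly_roots_finite[OF p0] by (intro card_seteq) auto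
  moreover have "poly ?p z = 0" using z by (simp add: poly_monom)
  ultimately show ?thesis using that by blast
qed

section \<open>Self-reciprocal rational divisors of \<open>X^n - 1\<close>\<close>

lemma cnj_of_rat: "cnj (of_rat q) = of_rat q"
  by (cases q) (simp add: of_rat_rat)

text \<open>All complex roots of \<open>d\<close> lie on the unit circle, where conjugation is
  inversion. Reversing the coefficients inverts the roots, so up to a constant it acts as
  conjugation, which fixes rational coefficients.\<close>

lemma reflect_poly_rat_roots_of_unity:
  fixes d :: "rat poly"
  assumes n: "n > 0" and d: "d dvd monom 1 n - 1"
  obtains c where "reflect_poly d = smult c d"
proof -
  let ?r = "of_rat :: rat \<Rightarrow> complex"
  let ?m = "map_poly ?r"
  have mult: "?m (p * q) = ?m p * ?m q" for p q
    by (intro map_poly_mult_hom) (simp_all add: of_rat_add of_rat_mult)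
  have "monom (1::rat) n \<noteq> 1"
    using n by (metis degree_1 degree_monom_eq less_numeral_extra(3) zero_neq_one)
  then have d0: "d \<noteq> 0" using d by auto
  then have m0: "?m d \<noteq> 0" by (simp add: map_poly_eq_0_iff)
  have norm: "x * cnj x = 1" if "poly (?m d) x = 0" for x
  proof -
    from d have "?m d dvd ?m (monom 1 n - 1)" by (auto simp: mult elim!: dvdE)
    then have "poly (?m (monom 1 n - 1)) x = 0" using that by (auto elim!: dvdE)
    also have "?m (monom 1 n - 1) = monom 1 n - 1"
      by (intro poly_eqI) (simp add: coeff_map_poly of_rat_diff)
    finally have "x ^ n = 1" by (simp add: poly_monom)
    then have "norm x = 1" using n by (metis power_eq_1_iff not_gr_zero)
    then show ?thesis by (simp add: complex_norm_square[symmetric])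
  qed
  obtain A where A: "?m d = smult (lead_coeff (?m d)) (\<Prod>x\<in>#A. [:-x, 1:])"
    using alg_closed_imp_factorization[OF m0] by blast
  have roots: "x * cnj x = 1" if "x \<in># A" for x
    using that by (intro norm, subst A) (auto simp: poly_prod_mset)
  have cnj_d: "map_poly cnj (?m d) = ?m d"
    by (intro poly_eqI) (simp add: coeff_map_poly cnj_of_rat)
  have "\<exists>c. reflect_poly (\<Prod>x\<in>#A. [:-x, 1:]) = smult c (map_poly cnj (\<Prod>x\<in>#A. [:-x, 1:]))"
    using roots
  proof (induction A)
    case empty
    then show ?case by (intro exI[of _ 1]) simp
  next
    case (add x A)
    then obtain c where c: "reflect_poly (\<Prod>x\<in>#A. [:-x, 1:]) = smult c (map_poly cnj (\<Prod>x\<in>#A. [:-x, 1:]))"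
      by auto
    have "x \<noteq> 0" using add.prems[of x] by auto
    \<comment> \<open>Here \<open>1 - x X = -x (X - 1/x)\<close>, and \<open>1/x\<close> is the
      conjugate of \<open>x\<close>.\<close>
    then have x: "reflect_poly [:-x, 1:] = smult (-x) (map_poly cnj [:-x, 1:])"
      using add.prems[of x] by (simp add: reflect_poly_pCons map_poly_pCons)
    have "reflect_poly (\<Prod>x\<in>#add_mset x A. [:-x, 1:]) =
        smult (-x) (map_poly cnj [:-x, 1:]) * smult c (map_poly cnj (\<Prod>x\<in>#A. [:-x, 1:]))"
      by (simp only: image_mset_add_mset prod_mset.add_mset reflect_poly_mult x c)
    also have "\<dots> = smult (c * -x) (map_poly cnj (\<Prod>x\<in>#add_mset x A. [:-x, 1:]))"
      by (simp only: image_mset_add_mset prod_mset.add_mset mult_smult_left mult_smult_right smult_smult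
          map_poly_mult_hom complex_cnj_zero complex_cnj_add complex_cnj_mult)
    finally show ?case by blast
  qed
  then obtain c where c: "reflect_poly (\<Prod>x\<in>#A. [:-x, 1:]) = smult c (map_poly cnj (\<Prod>x\<in>#A. [:-x, 1:]))" ..
  define l where "l = lead_coeff (?m d)"
  have l: "l \<noteq> 0" "cnj l = l" using m0 by (auto simp: l_def lead_coeff_map_poly_nz d0 cnj_of_rat)
  have "reflect_poly (?m d) = smult l (reflect_poly (\<Prod>x\<in>#A. [:-x, 1:]))"
    by (subst A) (simp add: reflect_poly_smult l_def)
  also have "\<dots> = smult c (map_poly cnj (smult l (\<Prod>x\<in>#A. [:-x, 1:])))"
    by (simp add: c map_poly_smult l mult.commute)
  also have "\<dots> = smult c (?m d)" using A cnj_d by (simp add: l_def)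
  finally have eq: "reflect_poly (?m d) = smult c (?m d)" .
  have mr: "?r (coeff (reflect_poly d) j) = c * ?r (coeff d j)" for j
    using arg_cong[OF eq, of "\<lambda>p. coeff p j"]
    by (simp add: coeff_reflect_poly coeff_map_poly degree_map_poly split: if_splits)
  \<comment> \<open>So far \<open>c\<close> is only complex; comparing coefficients at the leading
    one, which is rational and nonzero, makes it rational.\<close>
  have "?r (coeff (reflect_poly d) (degree d) / lead_coeff d) = c"
    using mr[of "degree d"] d0 by (simp add: of_rat_divide)
  then obtain c' where "c = ?r c'" by metis
  then have "coeff (reflect_poly d) j = c' * coeff d j" for j
    using mr[of j] by (simp flip: of_rat_mult)
  then show ?thesis by (intro that[of c'] poly_eqI) simp
qed

text \<open>This plays the role of the automorphism inverting the roots of unity.\<close>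

lemma rat_poly_inverse_root_of_unity:
  fixes \<zeta> :: "'a::field_char_0" and q :: "rat poly"
  assumes n: "n > 0" and \<zeta>: "\<zeta> ^ n = 1" and q: "poly (map_poly of_rat q) \<zeta> = 0"
  shows "poly (map_poly of_rat q) (inverse \<zeta>) = 0"
proof -
  let ?m = "map_poly (of_rat :: rat \<Rightarrow> 'a)"
  have add: "?m (p + q) = ?m p + ?m q" for p q
    by (intro map_poly_add_hom) (simp_all add: of_rat_add)
  have mult: "?m (p * q) = ?m p * ?m q" for p q
    by (intro map_poly_mult_hom) (simp_all add: of_rat_add of_rat_mult)
  \<comment> \<open>By Bezout \<open>d\<close> still vanishes at \<open>\<zeta>\<close>, and as a
    divisor of \<open>X^n - 1\<close> it equals its reversal up to a nonzero constant, so its roots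
    are closed under inversion.\<close>
  define d where "d = gcd q (monom 1 n - 1)"
  have \<zeta>0: "\<zeta> \<noteq> 0" using \<zeta> n by (auto simp: power_0_left)
  have "?m (monom 1 n - 1) = monom 1 n - 1"
    by (intro poly_eqI) (simp add: coeff_map_poly of_rat_diff)
  then have 1: "poly (?m (monom 1 n - 1)) \<zeta> = 0" using \<zeta> by (simp add: poly_monom)
  obtain u v where "d = u * q + v * (monom 1 n - 1)"
    using bezout_coefficients_fst_snd[of q "monom 1 n - 1"] unfolding d_def by metis
  then have d\<zeta>: "poly (?m d) \<zeta> = 0" using 1 q by (simp add: add mult)
  obtain c where c: "reflect_poly d = smult c d"
    using reflect_poly_rat_roots_of_unity[OF n] d_def by auto
  have "d \<noteq> 0" using n unfolding d_def
    by (metis degree_1 degree_monom_eq gcd_eq_0_iff less_numeral_extra(3) right_minus_eq zero_neq_one)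
  then have c0: "c \<noteq> 0" using c by (metis reflect_poly_eq_0_iff smult_0_left)
  have "poly (?m (reflect_poly d)) (inverse \<zeta>) = poly (reflect_poly (?m d)) (inverse \<zeta>)"
    by (intro arg_cong2[of _ _ _ _ poly] poly_eqI refl)
      (simp add: coeff_map_poly coeff_reflect_poly degree_map_poly)
  also have "\<dots> = 0" using \<zeta>0 d\<zeta> by (simp add: poly_reflect_poly_nz)
  finally have "poly (?m d) (inverse \<zeta>) = 0" using c c0 by (simp add: map_poly_smult of_rat_mult)
  moreover have "d dvd q" by (simp add: d_def)
  ultimately show ?thesis by (auto simp: mult elim!: dvdE)
qed

text \<open>The same rational polynomials \<open>b j\<close> serve every \<open>\<zeta>\<close>, so
  the vanishing of a coefficient becomes a rational relation that can be moved from a root of unity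
  to its inverse.\<close>

lemma coeff_prod_linear_rat_poly:
  fixes ks :: "nat multiset"
  obtains b :: "nat \<Rightarrow> rat poly"
  where "\<And>(\<zeta>::'a::field_char_0) j. coeff (\<Prod>k\<in>#ks. [:-(\<zeta> ^ k), 1:]) j = poly (map_poly of_rat (b j)) \<zeta>"
proof -
  have "\<exists>b. \<forall>(\<zeta>::'a) j. coeff (\<Prod>k\<in>#ks. [:-(\<zeta> ^ k), 1:]) j = poly (map_poly of_rat (b j)) \<zeta>"
  proof (induction ks)
    case empty
    show ?case by (intro exI[of _ "\<lambda>j. if j = 0 then 1 else 0"]) simp
  next
    case (add k ks)
    then obtain b where b: "\<And>(\<zeta>::'a) j. coeff (\<Prod>k\<in>#ks. [:-(\<zeta> ^ k), 1:]) j = poly (map_poly of_rat (b j)) \<zeta>"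
      by blast
    let ?b = "\<lambda>j. (if j = 0 then 0 else b (j - 1)) + monom (-1) k * b j"
    have "coeff (\<Prod>k\<in>#add_mset k ks. [:-(\<zeta> ^ k), 1:]) j = poly (map_poly of_rat (?b j)) \<zeta>" for \<zeta> :: 'a and j
      by (cases j) (simp_all add: b map_poly_add_hom map_poly_mult_hom map_poly_monom poly_monom of_rat_add of_rat_mult)
    then show ?case by (intro exI[of _ ?b]) blast
  qed
  then show ?thesis using that by blast
qed

text \<open>Up to a nonzero constant, reversing \<open>F\<close> replaces a primitive root
  \<open>\<zeta>\<close> by its inverse in the formulas for the coefficients. A rational polynomial
  vanishes at both or at neither, so the support is symmetric even when the coefficients of
  \<open>F\<close> are not rational.\<close>

lemma symmetric_support_of_roots_of_unity:
  fixes F :: "'a::{alg_closed_field,field_char_0} poly"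
  assumes n: "n > 0" and roots: "\<And>z. poly F z = 0 \<Longrightarrow> z ^ n = 1"
    and j: "coeff F j \<noteq> 0"
  shows "coeff F (degree F - j) \<noteq> 0"
proof -
  have F0: "F \<noteq> 0" using j by auto
  obtain A where A: "F = smult (lead_coeff F) (\<Prod>z\<in>#A. [:-z, 1:])"
    using alg_closed_imp_factorization[OF F0] by blast
  obtain \<zeta> :: 'a where \<zeta>: "\<And>k. \<zeta> ^ k = 1 \<longleftrightarrow> n dvd k"
    using exists_primitive_root_of_unity[OF n] by blast
  have \<zeta>n: "\<zeta> ^ n = 1" "inverse \<zeta> ^ n = 1" using \<zeta> by (simp_all add: power_inverse)
  have \<zeta>0: "\<zeta> \<noteq> 0" using \<zeta>n(1) n by (auto simp: power_0_left)
  have "\<exists>k. z = \<zeta> ^ k" if "z \<in># A" for z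
  proof -
    have "poly F z = 0" using that by (subst A) (auto simp: poly_prod_mset)
    then show ?thesis using root_of_unity_is_power[OF n \<zeta> roots] by metis
  qed
  then obtain e where e: "\<And>z. z \<in># A \<Longrightarrow> z = \<zeta> ^ e z" by metis
  define ks where "ks = image_mset e A"
  define G where "G = (\<lambda>\<zeta>::'a. \<Prod>k\<in>#ks. [:-(\<zeta> ^ k), 1:])"
  have FG: "F = smult (lead_coeff F) (G \<zeta>)"
    unfolding G_def ks_def using e
    by (subst A) (simp add: image_mset.compositionality o_def e[symmetric] cong: image_mset_cong)
  obtain b :: "nat \<Rightarrow> rat poly" where b: "\<And>\<zeta> j. coeff (G \<zeta>) j = poly (map_poly of_rat (b j)) \<zeta>"
    unfolding G_def using coeff_prod_linear_rat_poly[where 'a='a and ks=ks] by metis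
  have "\<exists>c. c \<noteq> 0 \<and> reflect_poly (\<Prod>k\<in>#ks. [:-(\<zeta> ^ k), 1:]) = smult c (\<Prod>k\<in>#ks. [:-(inverse \<zeta> ^ k), 1:])" for ks
  proof (induction ks)
    case empty
    then show ?case by (intro exI[of _ 1]) simp
  next
    case (add k ks)
    then obtain c where c: "c \<noteq> 0" "reflect_poly (\<Prod>k\<in>#ks. [:-(\<zeta> ^ k), 1:]) = smult c (\<Prod>k\<in>#ks. [:-(inverse \<zeta> ^ k), 1:])"
      by blast
    have k: "reflect_poly [:-(\<zeta> ^ k), 1:] = smult (-(\<zeta> ^ k)) [:-(inverse \<zeta> ^ k), 1:]"
      using \<zeta>0 by (simp add: reflect_poly_pCons flip: power_mult_distrib)
    have "reflect_poly (\<Prod>k\<in>#add_mset k ks. [:-(\<zeta> ^ k), 1:]) =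
        smult (c * -(\<zeta> ^ k)) (\<Prod>k\<in>#add_mset k ks. [:-(inverse \<zeta> ^ k), 1:])"
      by (simp only: image_mset_add_mset prod_mset.add_mset reflect_poly_mult k c
          mult_smult_left mult_smult_right smult_smult)
    moreover have "c * -(\<zeta> ^ k) \<noteq> 0" using c \<zeta>0 by simp
    ultimately show ?case by blast
  qed
  then obtain c where c: "c \<noteq> 0" "reflect_poly (G \<zeta>) = smult c (G (inverse \<zeta>))"
    unfolding G_def by metis
  have refl: "reflect_poly F = smult (lead_coeff F * c) (G (inverse \<zeta>))"
    by (subst FG) (simp add: reflect_poly_smult c)
  have "coeff (G \<zeta>) j \<noteq> 0" using j FG by (metis coeff_smult mult_zero_right)
  \<comment> \<open>Inversion is applied to \<open>inverse \<zeta>\<close>: a zero there would give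
    a zero at \<open>\<zeta>\<close>.\<close>
  then have "coeff (G (inverse \<zeta>)) j \<noteq> 0"
    unfolding b using rat_poly_inverse_root_of_unity[OF n \<zeta>n(2), of "b j"] by auto
  then have "coeff (reflect_poly F) j \<noteq> 0" using refl c F0 by simp
  then show ?thesis by (auto simp: coeff_reflect_poly split: if_splits)
qed

section \<open>Invariant preorders on torsion-free monoids\<close>

lemma nmult_0 [simp]: "nmult 0 s = 0"
  by (simp add: nmult_def)

lemma nmult_Suc: "nmult (Suc n) s = nmult n s + s"
  by (simp add: nmult_def)

lemma nmult_1 [simp]: "nmult (Suc 0) s = s"
  by (simp add: nmult_def)

lemma nmult_zero [simp]: "nmult n 0 = 0"
  by (simp add: nmult_def)

lemma nmult_add_left: "nmult (m + n) s = nmult m s + nmult n s"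
  by (induction n) (simp_all add: nmult_Suc add.assoc)

lemma nmult_add_right: "nmult n (s + t) = nmult n s + nmult n t"
  by (simp add: nmult_def sum.distrib)

lemma nmult_nmult: "nmult m (nmult n s) = nmult (m * n) s"
  by (induction m) (simp_all add: nmult_Suc nmult_add_left add.commute)

lemma poly_mapping_expand: "(\<Sum>t\<in>Poly_Mapping.keys f. Poly_Mapping.single t (Poly_Mapping.lookup f t)) = f"
  by (intro poly_mapping_eqI) (auto simp: lookup_sum lookup_single when_def in_keys_iff)

locale cancellative_torsion_free =
  fixes S :: "'s::comm_monoid_add itself"
  assumes canc: "cancellative_monoid S"
    and tf: "torsion_free_monoid S"
begin

lemma add_left_cancel_iff: "(a::'s) + b = a + c \<longleftrightarrow> b = c"
  using canc unfolding cancellative_monoid_def by blast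

lemma add_right_cancel_iff: "(b::'s) + a = c + a \<longleftrightarrow> b = c"
  by (metis add_left_cancel_iff add.commute)

lemma nmult_cancel: "n > 0 \<Longrightarrow> nmult n (a::'s) = nmult n b \<longleftrightarrow> a = b"
  using tf unfolding torsion_free_monoid_def by blast

lemma nmult_inj: "(s::'s) \<noteq> 0 \<Longrightarrow> nmult m s = nmult n s \<longleftrightarrow> m = n"
proof (induction m n rule: linorder_wlog)
  case (le m n)
  have "nmult n s = nmult m s + nmult (n - m) s"
    using le by (simp flip: nmult_add_left)
  then have "nmult m s = nmult n s \<longleftrightarrow> nmult (n - m) s = 0"
    by (metis add_left_cancel_iff add.right_neutral)
  also have "\<dots> \<longleftrightarrow> n - m = 0"
    using le nmult_cancel[of "n - m" s 0] by (cases "n - m = 0") auto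
  finally show ?case using le by auto
qed metis

text \<open>Such a \<open>P\<close> corresponds to a submonoid of the group of differences of
  \<open>S\<close>: read \<open>(a, b) \<in> P\<close> as \<open>b - a\<close> lying in it.
  Transitivity is derived in \<open>inv_preorder_trans\<close>.\<close>

definition inv_preorder :: "('s \<times> 's) set \<Rightarrow> bool"
  where "inv_preorder P \<longleftrightarrow>
    (\<forall>a. (a, a) \<in> P) \<and>
    (\<forall>a b c d. (a, b) \<in> P \<longrightarrow> (c, d) \<in> P \<longrightarrow> (a + c, b + d) \<in> P) \<and>
    (\<forall>a b c. (a + c, b + c) \<in> P \<longrightarrow> (a, b) \<in> P)"

definition root_closed :: "('s \<times> 's) set \<Rightarrow> bool"
  where "root_closed P \<longleftrightarrow> (\<forall>n a b. 0 < n \<longrightarrow> (nmult n a, nmult n b) \<in> P \<longrightarrow> (a, b) \<in> P)"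

lemma inv_preorderD:
  assumes "inv_preorder P"
  shows inv_preorder_refl: "(a, a) \<in> P"
    and inv_preorder_add: "(a, b) \<in> P \<Longrightarrow> (c, d) \<in> P \<Longrightarrow> (a + c, b + d) \<in> P"
    and inv_preorder_cancel: "(a + c, b + c) \<in> P \<Longrightarrow> (a, b) \<in> P"
  using assms unfolding inv_preorder_def by blast+

lemma inv_preorder_trans:
  assumes P: "inv_preorder P" and "(a, b) \<in> P" "(b, c) \<in> P"
  shows "(a, c) \<in> P"
  using inv_preorder_add[OF P assms(2,3)] inv_preorder_cancel[OF P, of a b c]
  by (simp add: add.commute)

lemma inv_preorder_nmult:
  assumes P: "inv_preorder P" and "(a, b) \<in> P"
  shows "(nmult n a, nmult n b) \<in> P"
  by (induction n) (simp_all add: nmult_Suc inv_preorder_refl[OF P] inv_preorder_add[OF P] assms(2))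

lemma inv_preorder_converse: "inv_preorder P \<Longrightarrow> inv_preorder (P\<inverse>)"
  unfolding inv_preorder_def by blast

text \<open>A symmetric, root-closed \<open>E\<close> is a congruence with torsion-free quotient,
  and such a quotient can be totally ordered, as in Levi's theorem for torsion-free abelian groups.
  Zorn's lemma gives a maximal root-closed preorder \<open>M\<close> identifying no more than
  \<open>E\<close>; if \<open>M\<close> lacks \<open>(b, a)\<close>, adjoining \<open>(a, b)\<close>
  stays admissible, so \<open>(a, b)\<close> is already in \<open>M\<close>.\<close>

lemma total_extension:
  assumes E: "inv_preorder E" "root_closed E" "sym E"
  obtains P where "inv_preorder P" "E \<subseteq> P" "P \<inter> P\<inverse> = E" "\<And>a b. (a, b) \<in> P \<or> (b, a) \<in> P"
proof -
  define Adm where "Adm = {P. inv_preorder P \<and> root_closed P \<and> E \<subseteq> P \<and> P \<inter> P\<inverse> \<subseteq> E}"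
  have "\<exists>M\<in>Adm. \<forall>R\<in>Adm. M \<subseteq> R \<longrightarrow> R = M"
  proof (rule subset_Zorn_nonempty)
    show "Adm \<noteq> {}" using E unfolding Adm_def by blast
  next
    fix C assume C: "C \<noteq> {}" "subset.chain Adm C"
    have mem: "R \<in> C \<Longrightarrow> R \<in> Adm" for R
      using C(2) by (auto simp: subset.chain_def)
    have lin: "\<exists>Z\<in>C. p \<in> Z \<and> q \<in> Z" if pq: "p \<in> \<Union>C" "q \<in> \<Union>C" for p q
    proof -
      obtain R Y where "R \<in> C" "Y \<in> C" "p \<in> R" "q \<in> Y" using pq by blast
      moreover have "R \<subseteq> Y \<or> Y \<subseteq> R"
        using C(2) calculation by (auto simp: subset.chain_def)
      ultimately show ?thesis by blast
    qed
    have "inv_preorder (\<Union>C)"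
      unfolding inv_preorder_def
    proof (intro conjI allI impI)
      fix a show "(a, a) \<in> \<Union>C" using C(1) mem unfolding Adm_def by (blast dest: inv_preorder_refl)
    next
      fix a b c d assume "(a, b) \<in> \<Union>C" "(c, d) \<in> \<Union>C"
      then obtain Z where "Z \<in> C" "(a, b) \<in> Z" "(c, d) \<in> Z" using lin by blast
      then show "(a + c, b + d) \<in> \<Union>C" using mem unfolding Adm_def by (blast dest: inv_preorder_add)
    next
      fix a b c assume "(a + c, b + c) \<in> \<Union>C"
      then show "(a, b) \<in> \<Union>C" using mem unfolding Adm_def by (blast dest: inv_preorder_cancel)
    qed
    moreover have "root_closed (\<Union>C)"
      using mem unfolding root_closed_def Adm_def by blast
    moreover have "E \<subseteq> \<Union>C" using C(1) mem unfolding Adm_def by blast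
    moreover have "\<Union>C \<inter> (\<Union>C)\<inverse> \<subseteq> E"
    proof
      fix p assume "p \<in> \<Union>C \<inter> (\<Union>C)\<inverse>"
      then obtain a b where p: "p = (a, b)" "(a, b) \<in> \<Union>C" "(b, a) \<in> \<Union>C" by (cases p) auto
      then obtain Z where "Z \<in> C" "(a, b) \<in> Z" "(b, a) \<in> Z" using lin by blast
      then show "p \<in> E" using mem p(1) unfolding Adm_def by blast
    qed
    ultimately show "\<Union>C \<in> Adm" unfolding Adm_def by blast
  qed
  then obtain M where M: "M \<in> Adm" and max: "\<And>R. R \<in> Adm \<Longrightarrow> M \<subseteq> R \<Longrightarrow> R = M" by blast
  have M': "inv_preorder M" "root_closed M" "E \<subseteq> M" "M \<inter> M\<inverse> \<subseteq> E"
    using M unfolding Adm_def by auto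
  have "(a, b) \<in> M" if ba: "(b, a) \<notin> M" for a b
  proof -
    \<comment> \<open>read additively, \<open>(x, y)\<close> lies in \<open>R\<close> iff \<open>n(y - x) \<ge> k(b - a)\<close>\<close>
    define R where "R = {(x, y). \<exists>n>0. \<exists>k. (nmult n x + nmult k b, nmult n y + nmult k a) \<in> M}"
    have MX: "M \<subseteq> R"
    proof (clarify)
      fix x y assume "(x, y) \<in> M"
      then show "(x, y) \<in> R" unfolding R_def
        by (intro CollectI case_prodI exI[of _ 1] conjI exI[of _ 0]) simp_all
    qed
    have "inv_preorder R"
      unfolding inv_preorder_def
    proof (intro conjI allI impI)
      fix c show "(c, c) \<in> R" using MX inv_preorder_refl[OF M'(1)] by blast
    next
      fix c d c' d' assume "(c, d) \<in> R" "(c', d') \<in> R"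
      then obtain n k n' k' where *: "n > 0" "n' > 0"
        "(nmult n c + nmult k b, nmult n d + nmult k a) \<in> M"
        "(nmult n' c' + nmult k' b, nmult n' d' + nmult k' a) \<in> M"
        unfolding R_def by blast
      have "(nmult n' (nmult n c + nmult k b) + nmult n (nmult n' c' + nmult k' b),
             nmult n' (nmult n d + nmult k a) + nmult n (nmult n' d' + nmult k' a)) \<in> M"
        by (rule inv_preorder_add[OF M'(1) inv_preorder_nmult[OF M'(1) *(3)] inv_preorder_nmult[OF M'(1) *(4)]])
      then have "(nmult (n * n') (c + c') + nmult (n' * k + n * k') b,
             nmult (n * n') (d + d') + nmult (n' * k + n * k') a) \<in> M"
        by (simp add: nmult_add_right nmult_add_left nmult_nmult mult.commute add_ac)
      then show "(c + c', d + d') \<in> R" unfolding R_def using *(1,2)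
        by (intro CollectI case_prodI exI[of _ "n * n'"] conjI exI) auto
    next
      fix c d e assume "(c + e, d + e) \<in> R"
      then obtain n k where *: "n > 0" "(nmult n (c + e) + nmult k b, nmult n (d + e) + nmult k a) \<in> M"
        unfolding R_def by blast
      then have "(nmult n c + nmult k b + nmult n e, nmult n d + nmult k a + nmult n e) \<in> M"
        by (simp add: nmult_add_right add_ac)
      then show "(c, d) \<in> R" unfolding R_def using *(1) inv_preorder_cancel[OF M'(1)] by blast
    qed
    moreover have "root_closed R"
      unfolding root_closed_def
    proof (intro allI impI)
      fix m :: nat and c d assume m: "m > 0" "(nmult m c, nmult m d) \<in> R"
      then obtain n k where "n > 0" "(nmult (n * m) c + nmult k b, nmult (n * m) d + nmult k a) \<in> M"
        unfolding R_def by (auto simp: nmult_nmult)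
      then show "(c, d) \<in> R" unfolding R_def using m(1)
        by (intro CollectI case_prodI exI[of _ "n * m"] conjI exI) auto
    qed
    moreover have "R \<inter> R\<inverse> \<subseteq> E"
    proof
      fix p assume "p \<in> R \<inter> R\<inverse>"
      then obtain x y where p: "p = (x, y)" "(x, y) \<in> R" "(y, x) \<in> R" by (cases p) auto
      then obtain n k n' k' where *: "n > 0" "n' > 0"
        "(nmult n x + nmult k b, nmult n y + nmult k a) \<in> M"
        "(nmult n' y + nmult k' b, nmult n' x + nmult k' a) \<in> M"
        unfolding R_def by blast
      have "(nmult n' (nmult n x + nmult k b) + nmult n (nmult n' y + nmult k' b),
             nmult n' (nmult n y + nmult k a) + nmult n (nmult n' x + nmult k' a)) \<in> M"
        by (rule inv_preorder_add[OF M'(1) inv_preorder_nmult[OF M'(1) *(3)] inv_preorder_nmult[OF M'(1) *(4)]])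
      then have "(nmult (n' * k + n * k') b + nmult (n * n') (x + y),
             nmult (n' * k + n * k') a + nmult (n * n') (x + y)) \<in> M"
        by (simp add: nmult_add_right nmult_add_left nmult_nmult mult.commute add_ac)
      then have "(nmult (n' * k + n * k') b, nmult (n' * k + n * k') a) \<in> M"
        by (rule inv_preorder_cancel[OF M'(1)])
      \<comment> \<open>The terms in \<open>x\<close> and \<open>y\<close> have cancelled. A
        positive coefficient would put \<open>(b, a)\<close> into \<open>M\<close> by
        root-closedness.\<close>
      then have "n' * k + n * k' = 0"
        using ba M'(2) unfolding root_closed_def by blast
      then have "k = 0" "k' = 0" using * by auto
      then have "(nmult n x, nmult n y) \<in> M" "(nmult n' y, nmult n' x) \<in> M"
        using * by simp_all
      then have "(x, y) \<in> M" "(y, x) \<in> M" using M'(2) *(1,2) unfolding root_closed_def by blast+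
      then show "p \<in> E" using M'(4) p(1) by blast
    qed
    ultimately have "R \<in> Adm" using MX M'(3) unfolding Adm_def by blast
    then have "R = M" using max MX by blast
    \<comment> \<open>With \<open>n = k = 1\<close> both sides of the defining relation are
      \<open>a + b\<close>.\<close>
    moreover have "(a, b) \<in> R" unfolding R_def
      by (intro CollectI case_prodI exI[of _ 1] conjI exI[of _ 1])
        (simp_all add: add.commute inv_preorder_refl[OF M'(1)])
    ultimately show ?thesis by blast
  qed
  moreover have "E \<subseteq> M\<inverse>" using M'(3) E(3) by (auto simp: sym_def)
  ultimately show ?thesis using that[of M] M' by blast
qed

text \<open>In the group of differences: some positive multiple of \<open>b - a\<close> is an
  integer multiple of \<open>s\<close>. The pair \<open>i\<close>, \<open>j\<close> encodes an
  integer of either sign.\<close>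

definition commensurable_rel :: "'s \<Rightarrow> ('s \<times> 's) set"
  where "commensurable_rel s =
    {(a, b). \<exists>n>0. \<exists>i j. nmult n a + nmult i s = nmult n b + nmult j s}"

lemma inv_preorder_commensurable_rel: "inv_preorder (commensurable_rel s)"
  unfolding inv_preorder_def
proof (intro conjI allI impI)
  fix a show "(a, a) \<in> commensurable_rel s" unfolding commensurable_rel_def by auto
next
  fix a b c d assume "(a, b) \<in> commensurable_rel s" "(c, d) \<in> commensurable_rel s"
  then obtain n i j n' i' j' where *: "n > 0" "n' > 0"
    "nmult n a + nmult i s = nmult n b + nmult j s"
    "nmult n' c + nmult i' s = nmult n' d + nmult j' s"
    unfolding commensurable_rel_def by blast
  have "nmult n' (nmult n a + nmult i s) + nmult n (nmult n' c + nmult i' s) =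
      nmult n' (nmult n b + nmult j s) + nmult n (nmult n' d + nmult j' s)"
    by (simp only: *)
  then have "nmult (n * n') (a + c) + nmult (n' * i + n * i') s =
      nmult (n * n') (b + d) + nmult (n' * j + n * j') s"
    by (simp add: nmult_add_right nmult_add_left nmult_nmult mult.commute add_ac)
  then show "(a + c, b + d) \<in> commensurable_rel s"
    unfolding commensurable_rel_def using *(1,2)
    by (intro CollectI case_prodI exI[of _ "n * n'"] conjI exI) auto
next
  fix a b c assume "(a + c, b + c) \<in> commensurable_rel s"
  then obtain n i j where *: "n > 0" "nmult n (a + c) + nmult i s = nmult n (b + c) + nmult j s"
    unfolding commensurable_rel_def by blast
  then have "(nmult n a + nmult i s) + nmult n c = (nmult n b + nmult j s) + nmult n c"
    by (simp add: nmult_add_right add_ac)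
  then have "nmult n a + nmult i s = nmult n b + nmult j s"
    using add_right_cancel_iff by blast
  then show "(a, b) \<in> commensurable_rel s" using *(1) unfolding commensurable_rel_def by blast
qed

lemma root_closed_commensurable_rel: "root_closed (commensurable_rel s)"
  unfolding root_closed_def
proof (intro allI impI)
  fix m :: nat and a b assume m: "m > 0" "(nmult m a, nmult m b) \<in> commensurable_rel s"
  then obtain n i j where "n > 0" "nmult (n * m) a + nmult i s = nmult (n * m) b + nmult j s"
    unfolding commensurable_rel_def by (auto simp: nmult_nmult)
  then show "(a, b) \<in> commensurable_rel s" unfolding commensurable_rel_def using m(1)
    by (intro CollectI case_prodI exI[of _ "n * m"] conjI exI) auto
qed

lemma sym_commensurable_rel: "sym (commensurable_rel s)"
  unfolding commensurable_rel_def sym_def by (blast intro: sym)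

text \<open>Through this, \<open>total_extension\<close> at \<open>s = 0\<close> yields a total
  order on \<open>S\<close>.\<close>

lemma commensurable_rel_0: "commensurable_rel 0 = Id"
  unfolding commensurable_rel_def using nmult_cancel by auto

text \<open>At most one term of the convolution reaches \<open>x + y\<close>; if \<open>x\<close> or
  \<open>y\<close> lies outside the supports, none does and both sides are 0.\<close>

lemma lookup_mult_unique_sum:
  fixes f g :: "'s \<Rightarrow>\<^sub>0 'k::comm_ring_1"
  assumes "\<And>t u. t \<in> Poly_Mapping.keys f \<Longrightarrow> u \<in> Poly_Mapping.keys g \<Longrightarrow> t + u = x + y \<Longrightarrow> t = x \<and> u = y"
  shows "Poly_Mapping.lookup (f * g) (x + y) = Poly_Mapping.lookup f x * Poly_Mapping.lookup g y"
proof -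
  have "f * g = (\<Sum>t\<in>Poly_Mapping.keys f. \<Sum>u\<in>Poly_Mapping.keys g.
      Poly_Mapping.single (t + u) (Poly_Mapping.lookup f t * Poly_Mapping.lookup g u))"
    by (subst poly_mapping_expand[of f, symmetric], subst poly_mapping_expand[of g, symmetric])
      (simp add: sum_product mult_single)
  then have "Poly_Mapping.lookup (f * g) (x + y) =
      (\<Sum>t\<in>Poly_Mapping.keys f. \<Sum>u\<in>Poly_Mapping.keys g. Poly_Mapping.lookup f t * Poly_Mapping.lookup g u when t + u = x + y)"
    by (simp add: lookup_sum lookup_single)
  also have "\<dots> = (\<Sum>t\<in>Poly_Mapping.keys f. \<Sum>u\<in>Poly_Mapping.keys g. if u = y then (if t = x then Poly_Mapping.lookup f x * Poly_Mapping.lookup g y else 0) else 0)"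
    using assms by (intro sum.cong refl) (auto simp: when_def)
  also have "\<dots> = Poly_Mapping.lookup f x * Poly_Mapping.lookup g y"
    by (cases "Poly_Mapping.lookup g y = 0"; cases "Poly_Mapping.lookup f x = 0") (auto simp: in_keys_iff)
  finally show ?thesis .
qed

lemma inv_preorder_finite_max:
  assumes P: "inv_preorder P" "\<And>a b. (a, b) \<in> P \<or> (b, a) \<in> P"
    and A: "finite A" "A \<noteq> {}"
  shows "\<exists>x\<in>A. \<forall>t\<in>A. (t, x) \<in> P"
  using A
proof (induction A rule: finite_ne_induct)
  case (singleton x)
  then show ?case using inv_preorder_refl[OF P(1)] by blast
next
  case (insert a A)
  then obtain x where "x \<in> A" "\<forall>t\<in>A. (t, x) \<in> P" by blast
  then show ?case using P(2)[of a x] inv_preorder_trans[OF P(1)] inv_preorder_refl[OF P(1)] by blast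
qed

text \<open>Ties in the preorder are broken by an auxiliary total order, so that the product of the
  two maximal terms is not cancelled.\<close>

lemma keys_mult_max:
  fixes f g :: "'s \<Rightarrow>\<^sub>0 'k::idom"
  assumes P: "inv_preorder P" "\<And>a b. (a, b) \<in> P \<or> (b, a) \<in> P"
    and fg: "f \<noteq> 0" "g \<noteq> 0"
  obtains x y where "x \<in> Poly_Mapping.keys f" "y \<in> Poly_Mapping.keys g" "x + y \<in> Poly_Mapping.keys (f * g)"
    "\<And>t. t \<in> Poly_Mapping.keys f \<Longrightarrow> (t, x) \<in> P" "\<And>t. t \<in> Poly_Mapping.keys g \<Longrightarrow> (t, y) \<in> P"
proof -
  obtain L where L: "inv_preorder L" "L \<inter> L\<inverse> = Id" "\<And>a b. (a, b) \<in> L \<or> (b, a) \<in> L"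
    using total_extension[OF inv_preorder_commensurable_rel root_closed_commensurable_rel
      sym_commensurable_rel, of 0] by (metis commensurable_rel_0)
  define Q where "Q = {(a, b). (a, b) \<in> P \<and> ((b, a) \<in> P \<longrightarrow> (a, b) \<in> L)}"
  have Q: "inv_preorder Q"
    unfolding inv_preorder_def
  proof (intro conjI allI impI)
    fix a show "(a, a) \<in> Q" unfolding Q_def using inv_preorder_refl L(1) P(1) by blast
  next
    fix a b c d assume *: "(a, b) \<in> Q" "(c, d) \<in> Q"
    \<comment> \<open>A tie between the sums forces ties between the summands, so the tie-breaking
      relations can be added as well.\<close>
    have "(b, a) \<in> P \<and> (d, c) \<in> P" if "(b + d, a + c) \<in> P"
    proof -
      have "(b + d + c, a + c + d) \<in> P"
        using inv_preorder_add[OF P(1) that, of c d] * unfolding Q_def by blast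
      then have "(b + (c + d), a + (c + d)) \<in> P" by (simp add: add_ac)
      moreover have "(b + d + a, a + c + b) \<in> P"
        using inv_preorder_add[OF P(1) that, of a b] * unfolding Q_def by blast
      then have "(d + (a + b), c + (a + b)) \<in> P" by (simp add: add_ac)
      ultimately show ?thesis using inv_preorder_cancel[OF P(1)] by blast
    qed
    then show "(a + c, b + d) \<in> Q"
      using * inv_preorder_add[OF P(1)] inv_preorder_add[OF L(1)] unfolding Q_def by blast
  next
    fix a b c assume *: "(a + c, b + c) \<in> Q"
    then have "(a, b) \<in> P" using inv_preorder_cancel[OF P(1)] unfolding Q_def by blast
    moreover have "(a, b) \<in> L" if "(b, a) \<in> P"
      using * inv_preorder_add[OF P(1) that inv_preorder_refl[OF P(1)], of c]
        inv_preorder_cancel[OF L(1)] unfolding Q_def by blast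
    ultimately show "(a, b) \<in> Q" unfolding Q_def by blast
  qed
  have Q_total: "(a, b) \<in> Q \<or> (b, a) \<in> Q" for a b
    using P(2)[of a b] L(3)[of a b] unfolding Q_def by blast
  have Q_antisym: "a = b" if "(a, b) \<in> Q" "(b, a) \<in> Q" for a b
    using that L(2) unfolding Q_def by blast
  have "Poly_Mapping.keys f \<noteq> {}" "Poly_Mapping.keys g \<noteq> {}" using fg by simp_all
  then obtain x y where x: "x \<in> Poly_Mapping.keys f" "\<And>t. t \<in> Poly_Mapping.keys f \<Longrightarrow> (t, x) \<in> Q"
    and y: "y \<in> Poly_Mapping.keys g" "\<And>t. t \<in> Poly_Mapping.keys g \<Longrightarrow> (t, y) \<in> Q"
    using inv_preorder_finite_max[OF Q Q_total] finite_keys by metis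
  have "Poly_Mapping.lookup (f * g) (x + y) = Poly_Mapping.lookup f x * Poly_Mapping.lookup g y"
  proof (rule lookup_mult_unique_sum)
    fix t u assume tu: "t \<in> Poly_Mapping.keys f" "u \<in> Poly_Mapping.keys g" "t + u = x + y"
    \<comment> \<open>Since \<open>u\<close> is below \<open>y\<close>, \<open>x + u\<close> is
      below \<open>x + y = t + u\<close>; cancelling \<open>u\<close> puts \<open>x\<close> below
      \<open>t\<close>.\<close>
    have "(x + u, t + u) \<in> Q"
      using inv_preorder_add[OF Q inv_preorder_refl[OF Q] y(2)[OF tu(2)]] tu(3) by simp
    then have "(x, t) \<in> Q" by (rule inv_preorder_cancel[OF Q])
    then have "t = x" using Q_antisym x(2) tu(1) by blast
    then show "t = x \<and> u = y" using tu(3) add_left_cancel_iff by blast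
  qed
  then have "x + y \<in> Poly_Mapping.keys (f * g)" using x(1) y(1) by (simp add: in_keys_iff)
  then show ?thesis using that[OF x(1) y(1)] x(2) y(2) unfolding Q_def by blast
qed

text \<open>Let \<open>P\<close> be a total invariant preorder containing the relation. As 0 is in
  the support of \<open>g\<close>, its maximum \<open>y\<close> is at least 0, so the maximum
  \<open>x\<close> of the support of \<open>f\<close> is at most \<open>x + y\<close>, hence at most
  0. The converse preorder gives the opposite bound on \<open>t\<close>, and the two bounds together
  mean commensurability with 0.\<close>

lemma keys_commensurable:
  fixes f g :: "'s \<Rightarrow>\<^sub>0 'k::idom"
  assumes fg: "\<And>t. t \<in> Poly_Mapping.keys (f * g) \<Longrightarrow> (t, 0) \<in> commensurable_rel s"
    and 0: "0 \<in> Poly_Mapping.keys f" "0 \<in> Poly_Mapping.keys g" and t: "t \<in> Poly_Mapping.keys f"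
  shows "(t, 0) \<in> commensurable_rel s"
proof -
  let ?E = "commensurable_rel s"
  obtain P where P: "inv_preorder P" "P \<inter> P\<inverse> = ?E" "\<And>a b. (a, b) \<in> P \<or> (b, a) \<in> P"
    using total_extension[OF inv_preorder_commensurable_rel root_closed_commensurable_rel
      sym_commensurable_rel, of s] by metis
  have nz: "f \<noteq> 0" "g \<noteq> 0" using 0 by (metis keys_zero empty_iff)+
  have "(t, 0) \<in> P" if P: "inv_preorder P" "\<And>a b. (a, b) \<in> P \<or> (b, a) \<in> P" "?E \<subseteq> P" for P
  proof -
    obtain x y where xy: "x + y \<in> Poly_Mapping.keys (f * g)" "\<And>t. t \<in> Poly_Mapping.keys f \<Longrightarrow> (t, x) \<in> P"
      "\<And>t. t \<in> Poly_Mapping.keys g \<Longrightarrow> (t, y) \<in> P"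
      using keys_mult_max[OF P(1,2) nz] by metis
    have "(x + y, 0) \<in> P" using fg xy(1) P(3) by blast
    moreover have "(x + 0, x + y) \<in> P"
      using inv_preorder_add[OF P(1) inv_preorder_refl[OF P(1)]] xy(3) 0 by blast
    ultimately have "(x, 0) \<in> P" using inv_preorder_trans[OF P(1)] by simp
    then show ?thesis using xy(2)[OF t] inv_preorder_trans[OF P(1)] by blast
  qed
  note * = this
  have "(t, 0) \<in> P" using *[of P] P by blast
  moreover have "?E \<subseteq> P\<inverse>" using P(2) by blast
  then have "(t, 0) \<in> P\<inverse>" using *[of "P\<inverse>"] P(3) inv_preorder_converse[OF P(1)] by blast
  ultimately show ?thesis using P(2) by blast
qed

end

section \<open>Divisors in finite factorization monoids\<close>

lemma finite_multisets_size_le: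
  assumes "finite A"
  shows "finite {M. set_mset M \<subseteq> A \<and> size M \<le> n}"
proof -
  have "{M. set_mset M \<subseteq> A \<and> size M \<le> n} \<subseteq> mset ` {xs. set xs \<subseteq> A \<and> length xs \<le> n}"
  proof
    fix M assume M: "M \<in> {M. set_mset M \<subseteq> A \<and> size M \<le> n}"
    obtain xs where "mset xs = M" using ex_mset by blast
    then show "M \<in> mset ` {xs. set xs \<subseteq> A \<and> length xs \<le> n}" using M by auto
  qed
  then show ?thesis using finite_lists_length_le[OF assms] finite_surj by blast
qed

text \<open>One coordinate is refined at a time: a sequence of naturals has a monotone subsequence,
  and a decreasing one is constant from the index \<open>k\<close> where its minimum is attained, so
  shifting by \<open>k\<close> makes it monotone in the required sense.\<close>

lemma Dickson_subsequence:
  fixes f :: "nat \<Rightarrow> 'a \<Rightarrow> nat"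
  assumes "finite A"
  shows "\<exists>r::nat \<Rightarrow> nat. strict_mono r \<and> (\<forall>a\<in>A. mono (\<lambda>n. f (r n) a))"
  using assms
proof (induction A rule: finite_induct)
  case empty
  show ?case by (intro exI[of _ "\<lambda>n. n"]) (simp add: strict_mono_def)
next
  case (insert a A)
  then obtain r :: "nat \<Rightarrow> nat" where r: "strict_mono r" "\<And>b. b \<in> A \<Longrightarrow> mono (\<lambda>n. f (r n) b)" by blast
  have "\<exists>g::nat \<Rightarrow> nat. strict_mono g \<and> mono (\<lambda>n. f (r (g n)) a)"
  proof -
    obtain g where g: "strict_mono g" "monoseq (\<lambda>n. f (r (g n)) a)"
      using seq_monosub[of "\<lambda>n. f (r n) a"] by blast
    show ?thesis
    proof (cases "mono (\<lambda>n. f (r (g n)) a)")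
      case True
      then show ?thesis using g(1) by blast
    next
      case False
      then have dec: "f (r (g n)) a \<le> f (r (g m)) a" if "m \<le> n" for m n
        using g(2) that unfolding monoseq_def mono_def by blast
      obtain k where k: "\<And>n. f (r (g k)) a \<le> f (r (g n)) a"
        using ex_has_least_nat[of "\<lambda>_. True" 0 "\<lambda>n. f (r (g n)) a"] by auto
      have "f (r (g (n + k))) a = f (r (g k)) a" for n
        using k[of "n + k"] dec[of k "n + k"] by simp
      then have "mono (\<lambda>n. f (r (g (n + k))) a)" by (simp add: mono_def)
      moreover have "strict_mono (\<lambda>n. g (n + k))" using g(1) by (simp add: strict_mono_def)
      ultimately show ?thesis by blast
    qed
  qed
  then obtain g :: "nat \<Rightarrow> nat" where g: "strict_mono g" "mono (\<lambda>n. f (r (g n)) a)" by blast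
  have "mono (\<lambda>n. f (r (g n)) b)" if "b \<in> A" for b
    using r(2)[OF that] strict_mono_mono[OF g(1)] unfolding mono_def by blast
  moreover have "strict_mono (\<lambda>n. r (g n))" using strict_mono_o[OF r(1) g(1)] by (simp add: o_def)
  ultimately show ?case using g(2) by (intro exI[of _ "\<lambda>n. r (g n)"]) blast
qed

text \<open>The multiplicity functions live on the finite set \<open>A\<close>, so along a
  subsequence of distinct members all of them increase; distinctness makes the inclusion
  strict.\<close>

lemma Dickson_multiset:
  fixes Z :: "'a multiset set"
  assumes "infinite Z" "finite A" "\<And>M. M \<in> Z \<Longrightarrow> set_mset M \<subseteq> A"
  obtains M N where "M \<in> Z" "N \<in> Z" "M \<subset># N"
proof -
  obtain f :: "nat \<Rightarrow> 'a multiset" where f: "inj f" "range f \<subseteq> Z"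
    using assms(1) infinite_countable_subset by blast
  obtain r :: "nat \<Rightarrow> nat" where r: "strict_mono r" "\<And>a. a \<in> A \<Longrightarrow> mono (\<lambda>n. count (f (r n)) a)"
    using Dickson_subsequence[OF assms(2), of "\<lambda>n. count (f n)"] by blast
  have "f (r 0) \<subseteq># f (r 1)"
  proof (rule mset_subset_eqI)
    fix a show "count (f (r 0)) a \<le> count (f (r 1)) a"
    proof (cases "a \<in> A")
      case True
      then show ?thesis using r(2) by (simp add: mono_def)
    next
      case False
      then have "a \<notin># f (r 0)" using assms(3) f(2) by blast
      then show ?thesis by (simp add: not_in_iff)
    qed
  qed
  moreover have "f (r 0) \<noteq> f (r 1)"
    using f(1) r(1) by (metis inj_eq strict_mono_eq zero_neq_one)
  ultimately show ?thesis using that f(2) by (metis range_subsetD subset_mset.less_le)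
qed

section \<open>Divisors in a reduced cancellative torsion-free monoid\<close>

locale reduced_torsion_free = cancellative_torsion_free S for S :: "'s::comm_monoid_add itself" +
  assumes red: "reduced_monoid S"
begin

lemma madd_unit_iff: "madd_unit (u::'s) \<longleftrightarrow> u = 0"
  using red unfolding reduced_monoid_def madd_unit_def by auto

lemma add_eq_0: "(a::'s) + b = 0 \<longleftrightarrow> a = 0 \<and> b = 0"
  using madd_unit_iff[of a] madd_unit_iff[of b] unfolding madd_unit_def
  by (metis add.commute add.right_neutral)

lemma nmult_eq_0: "n > 0 \<Longrightarrow> nmult n (a::'s) = 0 \<longleftrightarrow> a = 0"
  using nmult_cancel[of n a 0] by simp

lemma madd_assoc_iff: "madd_assoc (a::'s) b \<longleftrightarrow> b = a"
  unfolding madd_assoc_def madd_unit_iff by auto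

text \<open>Only finitely many atoms divide \<open>x\<close>. The factorizations of \<open>x\<close>
  into atoms form an antichain, because the surplus atoms of a strictly larger one would sum to 0;
  by Dickson's lemma they are finitely many, and every divisor is the sum of a part of one of
  them.\<close>

lemma finite_madd_divisors:
  assumes ff: "finite_factorization_monoid TYPE('s)" and x: "(x::'s) \<noteq> 0"
  shows "finite {t. madd_dvd t x}"
proof -
  define A where "A = {a. madd_atom a \<and> madd_dvd a x}"
  have "finite ((\<lambda>a. {b. madd_assoc a b}) ` A)"
    using ff x unfolding finite_factorization_monoid_def madd_unit_iff A_def by blast
  then have finA: "finite A"
    by (rule finite_imageD) (auto simp: madd_assoc_iff inj_on_def)
  \<comment> \<open>Atomicity speaks only of nonunits; 0 is the sum of the empty multiset.\<close>
  have factor: "\<exists>M. (\<forall>a\<in>#M. madd_atom a) \<and> t = sum_mset M" for t :: 's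
    using ff unfolding finite_factorization_monoid_def atomic_monoid_def madd_unit_iff
  proof (cases "t = 0")
    case True
    then show ?thesis by (intro exI[of _ "{#}"]) simp
  qed blast
  define Z where "Z = {M. (\<forall>a\<in>#M. madd_atom a) \<and> sum_mset M = x}"
  have ZA: "set_mset M \<subseteq> A" if "M \<in> Z" for M
  proof
    fix a assume a: "a \<in># M"
    then obtain M' where "M = add_mset a M'" by (rule mset_add)
    then have "x = a + sum_mset M'" using that unfolding Z_def by simp
    then show "a \<in> A" using that a unfolding A_def Z_def madd_dvd_def by blast
  qed
  have "finite Z"
  proof (rule ccontr)
    assume "infinite Z"
    then obtain M N where MN: "M \<in> Z" "N \<in> Z" "M \<subset># N"
      using Dickson_multiset[OF _ finA ZA] by metis
    then obtain K where K: "N = M + K" "K \<noteq> {#}" by (metis add.right_neutral mset_subset_eq_exists_conv subset_mset.less_le)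
    then have "sum_mset M + sum_mset K = sum_mset M + 0" using MN(1,2) by (simp add: Z_def)
    then have K0: "sum_mset K = 0" using add_left_cancel_iff by blast
    obtain a K' where a: "K = add_mset a K'" using K(2) by (meson multiset_cases)
    then have "a = 0" using K0 by (simp add: add_eq_0)
    moreover have "madd_atom a" using MN(2) K(1) a by (simp add: Z_def)
    ultimately show False by (simp add: madd_atom_def madd_unit_iff)
  qed
  \<comment> \<open>A factorization of a divisor, joined with one of the complementary divisor, is a
    member of \<open>Z\<close>; this bounds both its atoms and its size.\<close>
  let ?Y = "\<Union>M\<in>Z. {M'. set_mset M' \<subseteq> A \<and> size M' \<le> size M}"
  have "finite ?Y" using \<open>finite Z\<close> finite_multisets_size_le[OF finA] by blast
  moreover have "{t. madd_dvd t x} \<subseteq> sum_mset ` ?Y"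
  proof
    fix t assume "t \<in> {t. madd_dvd t x}"
    then obtain r where r: "x = t + r" unfolding madd_dvd_def by blast
    obtain M M' where M: "\<forall>a\<in>#M. madd_atom a" "t = sum_mset M" "\<forall>a\<in>#M'. madd_atom a" "r = sum_mset M'"
      using factor by metis
    then have "M + M' \<in> Z" unfolding Z_def using r by auto
    moreover from this have "set_mset M \<subseteq> A" using ZA by fastforce
    ultimately have "M \<in> ?Y" by (intro UN_I[of "M + M'"]) auto
    then show "t \<in> sum_mset ` ?Y" using M(2) by blast
  qed
  ultimately show ?thesis using finite_surj by blast
qed

end

section \<open>Substituting monomials and dilating exponents\<close>

lemma single_power: "Poly_Mapping.single (s::'s::comm_monoid_add) (1::'k::comm_ring_1) ^ n = Poly_Mapping.single (nmult n s) 1"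
  by (induction n) (simp_all add: nmult_Suc mult_single add.commute)

text \<open>Substitution becomes an evaluation after extending scalars, from which its ring laws
  follow.\<close>

lemma poly_subst_monomial_altdef:
  fixes f :: "'k::comm_ring_1 poly" and s :: "'s::comm_monoid_add"
  shows "poly_subst_monomial f s = poly (map_poly (Poly_Mapping.single 0) f) (Poly_Mapping.single s 1)"
proof -
  have inj: "Poly_Mapping.single (0::'s) c = 0 \<longleftrightarrow> c = 0" for c :: 'k
    by (metis lookup_single_eq lookup_zero single_zero)
  show ?thesis
    unfolding poly_subst_monomial_def poly_altdef
    by (simp add: inj degree_map_poly coeff_map_poly single_power mult_single)
qed

lemma poly_subst_monomial_0 [simp]: "poly_subst_monomial 0 s = 0"
  by (simp add: poly_subst_monomial_altdef)

lemma poly_subst_monomial_1 [simp]: "poly_subst_monomial 1 s = 1"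
  by (simp add: poly_subst_monomial_altdef)

lemma poly_subst_monomial_pCons:
  "poly_subst_monomial (pCons a f) s = Poly_Mapping.single 0 a + Poly_Mapping.single s 1 * poly_subst_monomial f s"
  by (simp add: poly_subst_monomial_altdef map_poly_pCons)

lemma poly_subst_monomial_add:
  "poly_subst_monomial (f + g) s = poly_subst_monomial f s + poly_subst_monomial g s"
  by (simp add: poly_subst_monomial_altdef map_poly_add_hom single_add)

lemma poly_subst_monomial_mult:
  "poly_subst_monomial (f * g) s = poly_subst_monomial f s * poly_subst_monomial g s"
  by (simp add: poly_subst_monomial_altdef map_poly_mult_hom single_add mult_single)

lemma poly_subst_monomial_monom:
  "poly_subst_monomial (monom c n) s = Poly_Mapping.single (nmult n s) c"
  by (simp add: poly_subst_monomial_altdef map_poly_monom poly_monom single_power mult_single)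

lemma poly_subst_monomial_sum:
  "poly_subst_monomial (\<Sum>i\<in>A. f i) s = (\<Sum>i\<in>A. poly_subst_monomial (f i) s)"
  by (induction A rule: infinite_finite_induct) (simp_all add: poly_subst_monomial_add)

lemma poly_subst_monomial_pcompose_monom:
  "poly_subst_monomial (pcompose f (monom 1 n)) s = poly_subst_monomial f (nmult n s)"
  by (induction f)
    (simp_all add: pcompose_pCons poly_subst_monomial_add poly_subst_monomial_mult poly_subst_monomial_monom
      poly_subst_monomial_pCons)

text \<open>The endomorphism of the monoid algebra induced by multiplication by \<open>n\<close> on
  the exponents.\<close>

definition dilate :: "nat \<Rightarrow> ('s::comm_monoid_add \<Rightarrow>\<^sub>0 'k::comm_ring_1) \<Rightarrow> ('s \<Rightarrow>\<^sub>0 'k)"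
  where "dilate n f = (\<Sum>t\<in>Poly_Mapping.keys f. Poly_Mapping.single (nmult n t) (Poly_Mapping.lookup f t))"

lemma dilate_superset:
  assumes "finite A" "Poly_Mapping.keys f \<subseteq> A"
  shows "dilate n f = (\<Sum>t\<in>A. Poly_Mapping.single (nmult n t) (Poly_Mapping.lookup f t))"
  unfolding dilate_def using assms by (intro sum.mono_neutral_left) (auto simp: in_keys_iff)

lemma dilate_0 [simp]: "dilate n 0 = 0"
  by (simp add: dilate_def)

lemma dilate_single [simp]: "dilate n (Poly_Mapping.single t c) = Poly_Mapping.single (nmult n t) c"
  by (simp add: dilate_superset[of "{t}"])

lemma dilate_1 [simp]: "dilate n 1 = 1"
  using dilate_single[of n 0 1] by simp

lemma dilate_add: "dilate n (f + g) = dilate n f + dilate n g"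
proof -
  let ?A = "Poly_Mapping.keys f \<union> Poly_Mapping.keys g"
  have "dilate n h = (\<Sum>t\<in>?A. Poly_Mapping.single (nmult n t) (Poly_Mapping.lookup h t))"
    if "h \<in> {f, g, f + g}" for h
    using that Poly_Mapping.keys_add[of f g] by (intro dilate_superset) auto
  then show ?thesis by (simp add: lookup_add single_add sum.distrib)
qed

lemma dilate_sum: "dilate n (\<Sum>i\<in>A. f i) = (\<Sum>i\<in>A. dilate n (f i))"
  by (induction A rule: infinite_finite_induct) (simp_all add: dilate_add)

lemma dilate_mult: "dilate n (f * g) = dilate n f * dilate n g"
proof -
  have "dilate n (f * g) = dilate n (\<Sum>t\<in>Poly_Mapping.keys f. \<Sum>u\<in>Poly_Mapping.keys g.
      Poly_Mapping.single (t + u) (Poly_Mapping.lookup f t * Poly_Mapping.lookup g u))"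
    by (subst (1) poly_mapping_expand[of f, symmetric], subst (1) poly_mapping_expand[of g, symmetric])
      (simp add: sum_product mult_single)
  also have "\<dots> = dilate n f * dilate n g"
    by (simp add: dilate_sum dilate_def[of n f] dilate_def[of n g] sum_product mult_single nmult_add_right)
  finally show ?thesis .
qed

lemma dilate_poly_subst_monomial: "dilate n (poly_subst_monomial f s) = poly_subst_monomial f (nmult n s)"
  by (simp add: poly_subst_monomial_def dilate_sum nmult_nmult mult.commute)

lemma keys_dilate: "Poly_Mapping.keys (dilate n f) \<subseteq> nmult n ` Poly_Mapping.keys f"
proof
  fix u assume "u \<in> Poly_Mapping.keys (dilate n f)"
  then have "(\<Sum>t\<in>Poly_Mapping.keys f. Poly_Mapping.lookup f t when nmult n t = u) \<noteq> 0"
    by (simp add: in_keys_iff dilate_def lookup_sum lookup_single)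
  then obtain t where "t \<in> Poly_Mapping.keys f" "(Poly_Mapping.lookup f t when nmult n t = u) \<noteq> 0"
    using sum.not_neutral_contains_not_neutral by blast
  then show "u \<in> nmult n ` Poly_Mapping.keys f" by (auto simp: when_def split: if_splits)
qed

lemma keys_poly_subst_monomial: "Poly_Mapping.keys (poly_subst_monomial f s) \<subseteq> range (\<lambda>k. nmult k s)"
proof
  fix u assume "u \<in> Poly_Mapping.keys (poly_subst_monomial f s)"
  then have "(\<Sum>k\<le>degree f. coeff f k when nmult k s = u) \<noteq> 0"
    by (simp add: in_keys_iff poly_subst_monomial_def lookup_sum lookup_single)
  then obtain k where "(coeff f k when nmult k s = u) \<noteq> 0"
    using sum.not_neutral_contains_not_neutral by blast
  then show "u \<in> range (\<lambda>k. nmult k s)" by (auto simp: when_def split: if_splits)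
qed

text \<open>Formally \<open>f\<close> is \<open>F\<close> evaluated at \<open>X^(s/n)\<close>. The
  equation is stated after dilation by \<open>n\<close> because \<open>s/n\<close> need not exist in
  the monoid.\<close>

definition represents :: "nat \<Rightarrow> 's::comm_monoid_add \<Rightarrow> ('s \<Rightarrow>\<^sub>0 'k::comm_ring_1) \<Rightarrow> 'k poly \<Rightarrow> bool"
  where "represents n s f F \<longleftrightarrow> dilate n f = poly_subst_monomial F s"

lemma represents_mult: "represents n s f F \<Longrightarrow> represents n s g G \<Longrightarrow> represents n s (f * g) (F * G)"
  by (simp add: represents_def dilate_mult poly_subst_monomial_mult)

lemma represents_1: "represents n s 1 1"
  by (simp add: represents_def)

lemma represents_prod_mset:
  "(\<And>f. f \<in># M \<Longrightarrow> represents n s f (F f)) \<Longrightarrow> represents n s (prod_mset M) (\<Prod>f\<in>#M. F f)"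
  by (induction M) (simp_all add: represents_1 represents_mult)

lemma represents_poly_subst_monomial:
  "represents n s (poly_subst_monomial A s) (pcompose A (monom 1 n))"
  by (simp add: represents_def dilate_poly_subst_monomial poly_subst_monomial_pcompose_monom)

lemma represents_exists:
  assumes "\<And>t. t \<in> Poly_Mapping.keys f \<Longrightarrow> \<exists>k. nmult n t = nmult k s"
  obtains F where "represents n s f F"
proof -
  obtain k where k: "\<And>t. t \<in> Poly_Mapping.keys f \<Longrightarrow> nmult n t = nmult (k t) s" using assms by metis
  have "represents n s f (\<Sum>t\<in>Poly_Mapping.keys f. monom (Poly_Mapping.lookup f t) (k t))"
    by (simp add: represents_def dilate_def poly_subst_monomial_sum poly_subst_monomial_monom k)
  then show ?thesis using that by blast
qed

section \<open>Recovering an element from its dilation\<close>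

context cancellative_torsion_free
begin

lemma lookup_dilate:
  "n > 0 \<Longrightarrow> Poly_Mapping.lookup (dilate n f) (nmult n t) = Poly_Mapping.lookup f (t::'s)"
  by (auto simp: dilate_def lookup_sum lookup_single nmult_cancel when_def in_keys_iff)

lemma dilate_inj: "n > 0 \<Longrightarrow> dilate n f = dilate n g \<Longrightarrow> f = (g :: 's \<Rightarrow>\<^sub>0 _)"
  by (metis lookup_dilate poly_mapping_eqI)

lemma lookup_poly_subst_monomial:
  "s \<noteq> 0 \<Longrightarrow> Poly_Mapping.lookup (poly_subst_monomial F s) (nmult k (s::'s)) = coeff F k"
  by (auto simp: poly_subst_monomial_def lookup_sum lookup_single nmult_inj when_def coeff_eq_0)

lemma represents_coeff:
  assumes "represents n (s::'s) f F" "s \<noteq> 0" "n > 0" "nmult n t = nmult k s"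
  shows "coeff F k = Poly_Mapping.lookup f t"
  using assms lookup_poly_subst_monomial[of s F k] lookup_dilate[of n f t] by (simp add: represents_def)

lemma represents_keys:
  assumes "represents n (s::'s) f F" "s \<noteq> 0" "coeff F k \<noteq> 0"
  obtains t where "t \<in> Poly_Mapping.keys f" "nmult n t = nmult k s"
proof -
  have "nmult k s \<in> Poly_Mapping.keys (dilate n f)"
    using assms lookup_poly_subst_monomial[of s F k] by (simp add: represents_def in_keys_iff)
  then show ?thesis using keys_dilate that by force
qed

lemma represents_unique:
  assumes "represents n (s::'s) f F" "represents n s f G" "s \<noteq> 0"
  shows "F = G"
proof (rule poly_eqI)
  fix k
  have "poly_subst_monomial F s = poly_subst_monomial G s"
    using assms(1,2) by (simp add: represents_def)
  then show "coeff F k = coeff G k"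
    using lookup_poly_subst_monomial[OF assms(3)] by metis
qed

lemma represents_smult:
  assumes "represents n (s::'s) f (smult c F)" "represents n s g F" "n > 0"
  shows "f = g * Poly_Mapping.single 0 c"
proof (rule dilate_inj[OF assms(3)])
  have "poly_subst_monomial (smult c F) s = poly_subst_monomial F s * Poly_Mapping.single 0 c"
    using poly_subst_monomial_mult[of F "[:c:]" s] by (simp add: poly_subst_monomial_pCons)
  then show "dilate n f = dilate n (g * Poly_Mapping.single 0 c)"
    using assms by (simp add: represents_def dilate_mult)
qed

text \<open>The elements that are nonnegative rational multiples of \<open>s\<close>.\<close>

definition ray :: "'s \<Rightarrow> 's set"
  where "ray s = {t. \<exists>n>0. \<exists>k. nmult n t = nmult k s}"

lemma ray_common_multiplier:
  assumes "finite A" "A \<subseteq> ray s"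
  shows "\<exists>n>0. \<forall>t\<in>A. \<exists>k. nmult n t = nmult k s"
  using assms
proof (induction A rule: finite_induct)
  case empty
  then show ?case by auto
next
  case (insert a A)
  then obtain n where n: "n > 0" "\<And>t. t \<in> A \<Longrightarrow> \<exists>k. nmult n t = nmult k s" by auto
  obtain m k where m: "m > 0" "nmult m a = nmult k s" using insert.prems by (auto simp: ray_def)
  have "\<exists>k. nmult (m * n) t = nmult k s" if t: "t \<in> insert a A" for t
  proof (cases "t = a")
    case True
    have "nmult (n * m) a = nmult (n * k) s" using m(2) by (simp flip: nmult_nmult)
    then show ?thesis using True by (metis mult.commute)
  next
    case False
    then obtain k where "nmult n t = nmult k s" using n(2) t by auto
    then have "nmult (m * n) t = nmult (m * k) s" by (simp flip: nmult_nmult)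
    then show ?thesis by blast
  qed
  then show ?case using n(1) m(1) by (intro exI[of _ "m * n"]) simp
qed

end

context reduced_torsion_free
begin

text \<open>The nonzero constant term puts 0 into the support of the product, and reducedness splits
  it only as \<open>0 + 0\<close>, so 0 lies in both supports. Then
  \<open>keys_commensurable\<close> makes \<open>t\<close> a rational multiple of \<open>s\<close>,
  and its sign remains to be settled.\<close>

lemma keys_divisor_subset_ray:
  fixes f g :: "'s \<Rightarrow>\<^sub>0 'k::field"
  assumes s: "s \<noteq> 0" and fg: "f * g = poly_subst_monomial A s" and A0: "coeff A 0 \<noteq> 0"
  shows "Poly_Mapping.keys f \<subseteq> ray s"
proof
  fix t assume t: "t \<in> Poly_Mapping.keys f"
  have "0 \<in> Poly_Mapping.keys (f * g)"
    using lookup_poly_subst_monomial[OF s, of A 0] A0 by (simp add: fg in_keys_iff)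
  then obtain a b where "a \<in> Poly_Mapping.keys f" "b \<in> Poly_Mapping.keys g" "0 = a + b"
    using Poly_Mapping.keys_mult[of f g] by blast
  then have 0: "0 \<in> Poly_Mapping.keys f" "0 \<in> Poly_Mapping.keys g"
    using add_eq_0 by metis+
  have "(u, 0) \<in> commensurable_rel s" if u: "u \<in> Poly_Mapping.keys (f * g)" for u
  proof -
    obtain k where k: "u = nmult k s" using u keys_poly_subst_monomial[of A s] fg by auto
    show ?thesis unfolding commensurable_rel_def k
      by (intro CollectI case_prodI exI[of _ 1] conjI exI[of _ 0] exI[of _ k]) simp_all
  qed
  then have "(t, 0) \<in> commensurable_rel s" using keys_commensurable 0 t by blast
  then obtain n i j where n: "n > 0" "nmult n t + nmult i s = nmult j s"
    unfolding commensurable_rel_def by auto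
  show "t \<in> ray s"
  proof (cases "i \<le> j")
    case True
    then have "nmult n t + nmult i s = nmult (j - i) s + nmult i s"
      using n(2) by (simp flip: nmult_add_left)
    then show ?thesis using n(1) add_right_cancel_iff unfolding ray_def by blast
  next
    case False
    \<comment> \<open>The multiple would be negative; reducedness then leaves only
      \<open>t = 0\<close>.\<close>
    then have "nmult i s = nmult (i - j) s + nmult j s" by (simp flip: nmult_add_left)
    then have "(nmult n t + nmult (i - j) s) + nmult j s = 0 + nmult j s"
      using n(2) by (simp add: add.assoc)
    then have "nmult n t + nmult (i - j) s = 0" using add_right_cancel_iff by blast
    then have "t = 0" using n(1) by (simp add: add_eq_0 nmult_eq_0)
    then show ?thesis unfolding ray_def
      by (intro CollectI exI[of _ 1] conjI exI[of _ 0]) simp_all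
  qed
qed

end

section \<open>Divisors of polynomials in a monomial\<close>

text \<open>One exponent is demanded for all roots. Since 0 is not a root of unity, this excludes
  the zero polynomial and a vanishing constant coefficient.\<close>

definition roots_of_unity_poly :: "'k::field poly \<Rightarrow> bool"
  where "roots_of_unity_poly A \<longleftrightarrow>
    (\<exists>n>0. \<forall>z :: 'k alg_closure. poly (map_poly to_ac A) z = 0 \<longrightarrow> z ^ n = 1)"

lemma map_poly_to_ac_mult: "map_poly to_ac (p * q) = map_poly to_ac p * map_poly to_ac q"
  by (intro map_poly_mult_hom) simp_all

lemma degree_map_poly_to_ac [simp]: "degree (map_poly to_ac p) = degree p"
  by (simp add: degree_map_poly)

text \<open>Each root has its own exponent; there are finitely many roots, and the product of their
  exponents serves them all.\<close>

lemma roots_of_unity_poly_prod: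
  assumes "\<And>p. p \<in># P \<Longrightarrow> cyclotomic_polynomial p"
  shows "roots_of_unity_poly (prod_mset P)"
proof -
  have ne: "prod_mset P \<noteq> 0"
    using assms unfolding cyclotomic_polynomial_def
    by (metis leading_coeff_0_iff prod_mset_zero_iff zero_neq_one)
  let ?R = "{z. poly (map_poly to_ac (prod_mset P)) z = 0}"
  have "map_poly to_ac (prod_mset P) \<noteq> 0" using ne by (simp add: map_poly_eq_0_iff)
  then have fin: "finite ?R" by (rule poly_roots_finite)
  have "map_poly to_ac (prod_mset P) = (\<Prod>p\<in>#P. map_poly to_ac p)"
    by (induction P) (simp_all add: map_poly_to_ac_mult)
  then have "\<exists>n>0. z ^ n = 1" if "z \<in> ?R" for z
    using that assms unfolding cyclotomic_polynomial_def by (auto simp: poly_prod_mset)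
  then obtain e :: "_ \<Rightarrow> nat" where e: "\<And>z. z \<in> ?R \<Longrightarrow> e z > 0 \<and> z ^ e z = 1" by metis
  have "z ^ (\<Prod>z\<in>?R. e z) = 1" if "z \<in> ?R" for z
    using e[OF that] prod.remove[OF fin that, of e] by (simp add: power_mult)
  moreover have "(\<Prod>z\<in>?R. e z) > 0" using e by (intro prod_pos) auto
  ultimately show ?thesis unfolding roots_of_unity_poly_def by blast
qed

lemma roots_of_unity_poly_dvd:
  "roots_of_unity_poly A \<Longrightarrow> F dvd A \<Longrightarrow> roots_of_unity_poly F"
  unfolding roots_of_unity_poly_def by (auto simp: map_poly_to_ac_mult elim!: dvdE)

lemma roots_of_unity_poly_pcompose_monom:
  fixes A :: "'k::field poly"
  assumes "roots_of_unity_poly A" "N > 0"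
  shows "roots_of_unity_poly (pcompose A (monom 1 N))"
proof -
  obtain n where n: "n > 0" "\<And>z :: 'k alg_closure. poly (map_poly to_ac A) z = 0 \<Longrightarrow> z ^ n = 1"
    using assms(1) unfolding roots_of_unity_poly_def by blast
  have "map_poly to_ac (pcompose A (monom 1 N)) = pcompose (map_poly to_ac A) (monom 1 N)"
    by (induction A)
      (simp_all add: pcompose_pCons map_poly_add_hom map_poly_to_ac_mult map_poly_pCons map_poly_monom)
  then have "z ^ (N * n) = 1" if "poly (map_poly to_ac (pcompose A (monom 1 N))) z = 0" for z
    using that n(2)[of "z ^ N"] by (simp add: poly_pcompose poly_monom power_mult)
  moreover have "N * n > 0" using n(1) assms(2) by simp
  ultimately show ?thesis unfolding roots_of_unity_poly_def by blast
qed

lemma roots_of_unity_poly_coeff_0: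
  assumes "roots_of_unity_poly A" shows "coeff A 0 \<noteq> 0"
proof
  assume "coeff A 0 = 0"
  then have "poly (map_poly to_ac A) 0 = 0" by (simp add: poly_0_coeff_0 coeff_map_poly)
  then obtain n where "n > (0::nat)" "(0 :: 'a alg_closure) ^ n = 1"
    using assms unfolding roots_of_unity_poly_def by blast
  then show False by (simp add: power_0_left)
qed

lemma roots_of_unity_poly_coeff_sym:
  fixes F :: "'k::field_char_0 poly"
  assumes "roots_of_unity_poly F" "coeff F j \<noteq> 0"
  shows "coeff F (degree F - j) \<noteq> 0"
  using assms symmetric_support_of_roots_of_unity[of _ "map_poly to_ac F" j]
  unfolding roots_of_unity_poly_def by (auto simp: coeff_map_poly)

context reduced_torsion_free
begin

text \<open>Here \<open>n\<close> may depend on \<open>f\<close> and \<open>g\<close>. This is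
  enough to confine the supports, after which \<open>divisor_common_represents\<close> makes
  \<open>n\<close> uniform.\<close>

lemma divisor_represents:
  fixes f g :: "'s \<Rightarrow>\<^sub>0 'k::field"
  assumes s: "s \<noteq> 0" and fg: "f * g = poly_subst_monomial A s" and A0: "coeff A 0 \<noteq> 0"
  obtains n F G where "n > 0" "represents n s f F" "represents n s g G" "F * G = pcompose A (monom 1 n)"
proof -
  have "Poly_Mapping.keys f \<union> Poly_Mapping.keys g \<subseteq> ray s"
    using keys_divisor_subset_ray[OF s fg A0] keys_divisor_subset_ray[OF s _ A0, of g f] fg
    by (simp add: mult.commute)
  then obtain n where n: "n > 0"
    "\<And>t. t \<in> Poly_Mapping.keys f \<union> Poly_Mapping.keys g \<Longrightarrow> \<exists>k. nmult n t = nmult k s"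
    using ray_common_multiplier[of "Poly_Mapping.keys f \<union> Poly_Mapping.keys g" s] by auto
  obtain F where F: "represents n s f F" using represents_exists[of f n s] n(2) by blast
  obtain G where G: "represents n s g G" using represents_exists[of g n s] n(2) by blast
  have "represents n s (poly_subst_monomial A s) (F * G)"
    using represents_mult[OF F G] fg by simp
  then have "F * G = pcompose A (monom 1 n)"
    using represents_unique[OF _ represents_poly_subst_monomial s] by blast
  then show ?thesis using that n(1) F G by blast
qed

text \<open>If \<open>t\<close> corresponds to the exponent \<open>k\<close> of \<open>F\<close>,
  the symmetric exponent \<open>degree F - k\<close> yields an element \<open>t'\<close> with
  \<open>t + t'\<close> the top exponent of \<open>f\<close>. Adding the top exponent
  \<open>e\<close> of \<open>g\<close> gives \<open>nmult (degree A) s\<close>.\<close>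

lemma keys_divisor_madd_dvd:
  fixes f g :: "'s \<Rightarrow>\<^sub>0 'k::field_char_0"
  assumes s: "s \<noteq> 0" and fg: "f * g = poly_subst_monomial A s" and A: "roots_of_unity_poly A"
    and t: "t \<in> Poly_Mapping.keys f"
  shows "madd_dvd t (nmult (degree A) s)"
proof -
  obtain n F G where n: "n > 0" and F: "represents n s f F" and G: "represents n s g G"
    and FG: "F * G = pcompose A (monom 1 n)"
    by (rule divisor_represents[OF s fg roots_of_unity_poly_coeff_0[OF A]])
  have B: "roots_of_unity_poly (F * G)" unfolding FG by (rule roots_of_unity_poly_pcompose_monom[OF A n])
  then have RF: "roots_of_unity_poly F" by (rule roots_of_unity_poly_dvd) simp
  have nz: "F \<noteq> 0" "G \<noteq> 0" using roots_of_unity_poly_coeff_0[OF B] by auto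
  have "degree (F * G) = degree A * n"
    by (simp add: FG degree_pcompose degree_monom_eq)
  then have "degree F + degree G = degree A * n"
    by (simp add: degree_mult_eq nz)
  then have deg: "nmult (degree F) s + nmult (degree G) s = nmult (degree A * n) s"
    by (simp flip: nmult_add_left)
  have "\<exists>k. nmult n t = nmult k s"
  proof -
    have "nmult n t \<in> Poly_Mapping.keys (dilate n f)"
      using t lookup_dilate[OF n, of f t] by (simp add: in_keys_iff)
    then show ?thesis using F keys_poly_subst_monomial[of F s] unfolding represents_def by auto
  qed
  then obtain k where k: "nmult n t = nmult k s" by blast
  have ck: "coeff F k \<noteq> 0" using represents_coeff[OF F s n k] t by (simp add: in_keys_iff)
  then have kd: "k \<le> degree F" by (rule le_degree)
  \<comment> \<open>The difference of the top exponent and \<open>t\<close> exists in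
    \<open>S\<close> only because the symmetric coefficient of \<open>F\<close> is nonzero and so
    comes from an actual exponent of \<open>f\<close>.\<close>
  obtain t' where t': "nmult n t' = nmult (degree F - k) s"
    using represents_keys[OF F s roots_of_unity_poly_coeff_sym[OF RF ck]] by metis
  obtain e where e: "nmult n e = nmult (degree G) s"
    using represents_keys[OF G s, of "degree G"] nz by auto
  have "nmult n (t + t' + e) = nmult (k + (degree F - k)) s + nmult (degree G) s"
    by (simp add: nmult_add_right nmult_add_left k t' e del: le_add_diff_inverse)
  also have "\<dots> = nmult n (nmult (degree A) s)"
    using kd deg by (simp add: nmult_nmult mult.commute)
  finally have "t + t' + e = nmult (degree A) s" using nmult_cancel[OF n] by blast
  then show ?thesis unfolding madd_dvd_def by (metis add.assoc)
qed

text \<open>All divisors have their supports in one finite set, the divisors of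
  \<open>nmult (degree A) s\<close> on the ray, so a common denominator for that set serves every
  \<open>f\<close>.\<close>

lemma divisor_common_represents:
  fixes A :: "'k::field_char_0 poly"
  assumes ff: "finite_factorization_monoid TYPE('s)"
    and s: "(s::'s) \<noteq> 0" and A: "roots_of_unity_poly A" "degree A > 0"
  obtains n where "n > 0"
    "\<And>f. f dvd poly_subst_monomial A s \<Longrightarrow> \<exists>F. F dvd pcompose A (monom 1 n) \<and> represents n s f F"
proof -
  have A0: "coeff A 0 \<noteq> 0" by (rule roots_of_unity_poly_coeff_0[OF A(1)])
  let ?D = "{t \<in> ray s. madd_dvd t (nmult (degree A) s)}"
  have "nmult (degree A) s \<noteq> 0" using s A(2) by (simp add: nmult_eq_0)
  then have "finite ?D" using finite_madd_divisors[OF ff] by simp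
  then obtain n where n: "n > 0" "\<And>t. t \<in> ?D \<Longrightarrow> \<exists>k. nmult n t = nmult k s"
    using ray_common_multiplier[of ?D s] by auto
  have rep: "\<exists>F. represents n s f F" if fg: "f * g = poly_subst_monomial A s" for f g :: "'s \<Rightarrow>\<^sub>0 'k"
  proof -
    have sub: "Poly_Mapping.keys f \<subseteq> ?D"
      using keys_divisor_madd_dvd[OF s fg A(1)] keys_divisor_subset_ray[OF s fg A0] by blast
    obtain F where "represents n s f F"
      by (rule represents_exists[of f n s]) (rule n(2), rule subsetD[OF sub])
    then show ?thesis by blast
  qed
  have "\<exists>F. F dvd pcompose A (monom 1 n) \<and> represents n s f F"
    if f: "f dvd poly_subst_monomial A s" for f :: "'s \<Rightarrow>\<^sub>0 'k"
  proof -
    obtain g where fg: "f * g = poly_subst_monomial A s" using f by (metis dvdE)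
    have gf: "g * f = poly_subst_monomial A s" using fg by (simp add: mult.commute)
    obtain F G where FG: "represents n s f F" "represents n s g G"
      using rep[OF fg] rep[OF gf] by blast
    have "represents n s (poly_subst_monomial A s) (F * G)"
      using represents_mult[OF FG] fg by simp
    then have "F * G = pcompose A (monom 1 n)"
      using represents_unique[OF _ represents_poly_subst_monomial s] by blast
    then show ?thesis using FG(1) by (metis dvd_triv_left)
  qed
  then show ?thesis using that n(1) by blast
qed

end

section \<open>Associate classes and monic divisors\<close>

lemma ring_assoc_class_eqI:
  fixes f g u :: "'a::comm_ring_1"
  assumes "f = g * u" "u dvd 1"
  shows "{b. ring_assoc f b} = {b. ring_assoc g b}"
proof -
  have *: "ring_assoc x b" if "ring_assoc (x * w) b" "w dvd 1" for x w b :: 'a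
  proof -
    obtain z where "z dvd 1" "b = x * w * z" using \<open>ring_assoc (x * w) b\<close> unfolding ring_assoc_def by blast
    moreover have "w * z dvd 1" using mult_dvd_mono[OF that(2) \<open>z dvd 1\<close>] by simp
    ultimately show ?thesis unfolding ring_assoc_def by (metis mult.assoc)
  qed
  obtain v where v: "1 = u * v" using assms(2) by (rule dvdE)
  then have "g = f * v" using assms(1) by (metis mult.assoc mult.right_neutral)
  moreover have "v dvd 1" using v by (metis dvd_triv_right)
  ultimately have "ring_assoc f b \<longleftrightarrow> ring_assoc g b" for b
    using *[of g u b] *[of f v b] assms by metis
  then show ?thesis by simp
qed

lemma single_0_dvd_1:
  "(c::'k::field) \<noteq> 0 \<Longrightarrow> Poly_Mapping.single (0::'s::comm_monoid_add) c dvd 1"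
  by (intro dvdI[of _ _ "Poly_Mapping.single 0 (inverse c)"]) (simp add: mult_single)

text \<open>Over the algebraic closure a monic divisor is determined by its multiset of roots, which
  is drawn from the finitely many roots of \<open>B\<close> and has size at most
  \<open>degree B\<close>.\<close>

lemma finite_monic_divisors:
  fixes B :: "'k::field poly"
  assumes B: "B \<noteq> 0"
  shows "finite {F. F dvd B \<and> lead_coeff F = 1}"
proof -
  let ?R = "{z. poly (map_poly to_ac B) z = 0}"
  have "map_poly to_ac B \<noteq> 0" using B by (simp add: map_poly_eq_0_iff)
  then have "finite ?R" by (rule poly_roots_finite)
  then have fin: "finite {M. set_mset M \<subseteq> ?R \<and> size M \<le> degree B}" by (rule finite_multisets_size_le)
  let ?F = "{F. F dvd B \<and> lead_coeff F = 1}"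
  have "map_poly to_ac ` ?F \<subseteq> (\<lambda>M. \<Prod>z\<in>#M. [:-z, 1:]) ` {M. set_mset M \<subseteq> ?R \<and> size M \<le> degree B}"
  proof
    fix p assume "p \<in> map_poly to_ac ` ?F"
    then obtain F where F: "p = map_poly to_ac F" "F dvd B" "lead_coeff F = 1" by blast
    have "lead_coeff p = 1" using F by (simp add: coeff_map_poly)
    then have "p \<noteq> 0" by auto
    then obtain M where M: "size M = degree p" "p = (\<Prod>z\<in>#M. [:-z, 1:])"
      using alg_closed_imp_factorization[of p] \<open>lead_coeff p = 1\<close> by auto
    have "size M \<le> degree B" using M(1) F(1,2) B by (simp add: dvd_imp_degree_le)
    moreover have "z \<in> ?R" if "z \<in># M" for z
    proof -
      have "poly p z = 0" using that by (auto simp: M(2) poly_prod_mset)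
      then show ?thesis using F(1,2) by (auto simp: map_poly_to_ac_mult elim!: dvdE)
    qed
    ultimately show "p \<in> (\<lambda>M. \<Prod>z\<in>#M. [:-z, 1:]) ` {M. set_mset M \<subseteq> ?R \<and> size M \<le> degree B}"
      using M(2) by blast
  qed
  then have "finite (map_poly to_ac ` ?F)" using fin finite_surj by blast
  moreover have "inj (map_poly (to_ac :: 'k \<Rightarrow> _))"
  proof (rule injI, rule poly_eqI)
    fix p q :: "'k poly" and n assume "map_poly to_ac p = map_poly to_ac q"
    then have "coeff (map_poly to_ac p) n = coeff (map_poly to_ac q) n" by simp
    then show "coeff p n = coeff q n" by (simp add: coeff_map_poly)
  qed
  ultimately show ?thesis by (meson finite_imageD inj_on_subset subset_UNIV)
qed

lemma size_le_degree_prod_mset: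
  fixes F :: "'a \<Rightarrow> 'k::field poly"
  assumes "\<And>a. a \<in># M \<Longrightarrow> degree (F a) > 0"
  shows "(\<Prod>a\<in>#M. F a) \<noteq> 0 \<and> size M \<le> degree (\<Prod>a\<in>#M. F a)"
  using assms
proof (induction M)
  case (add a M)
  then have "degree (F a) > 0" "(\<Prod>a\<in>#M. F a) \<noteq> 0 \<and> size M \<le> degree (\<Prod>a\<in>#M. F a)" by auto
  moreover from this have "F a \<noteq> 0" by auto
  ultimately show ?case by (simp add: degree_mult_eq)
qed simp

section \<open>Finiteness of the set of factorizations\<close>

context reduced_torsion_free
begin

text \<open>With a uniform \<open>n\<close>, each divisor of \<open>h\<close> is represented by a
  divisor of \<open>B\<close>, whose monic normalization \<open>m f\<close> fixes the associate
  class. This leaves finitely many classes, and \<open>degree B\<close> bounds the number of nonunit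
  factors.\<close>

lemma FF_property_roots_of_unity:
  fixes A :: "'k::field_char_0 poly"
  assumes ff: "finite_factorization_monoid TYPE('s)"
    and s: "(s::'s) \<noteq> 0" and A: "roots_of_unity_poly A" "degree A > 0"
  shows "FF_property (poly_subst_monomial A s)"
proof -
  define h where "h = poly_subst_monomial A s"
  have A0: "coeff A 0 \<noteq> 0" by (rule roots_of_unity_poly_coeff_0[OF A(1)])
  have "Poly_Mapping.lookup h (nmult 0 s) \<noteq> 0" using A0 lookup_poly_subst_monomial[OF s, of A 0] by (simp add: h_def)
  then have h0: "h \<noteq> 0" by auto
  have deg_pos: "degree (pcompose A (monom 1 n)) > 0" if "n > 0" for n
    using A(2) that by (simp add: degree_pcompose degree_monom_eq)
  have h1: "\<not> h dvd 1"
  proof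
    assume "h dvd 1"
    \<comment> \<open>An inverse of \<open>h\<close> would make its representing polynomial divide
      1, although that polynomial is \<open>A\<close> composed with \<open>Y^n\<close> and has
      positive degree.\<close>
    then obtain g where hg: "h * g = poly_subst_monomial 1 s" by (metis dvdE poly_subst_monomial_1)
    have c1: "coeff (1 :: 'k poly) 0 \<noteq> 0" by simp
    obtain n H G where n: "n > 0" "represents n s h H" "represents n s g G" "H * G = pcompose 1 (monom 1 n)"
      by (rule divisor_represents[OF s hg c1])
    have "H = pcompose A (monom 1 n)"
      by (rule represents_unique[OF n(2) _ s]) (simp add: h_def represents_poly_subst_monomial)
    moreover have "H dvd 1" using n(4) by (metis dvd_triv_left pcompose_1)
    ultimately show False using deg_pos[OF n(1)] dvd_imp_degree_le[of H 1] by simp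
  qed
  obtain n where n: "n > 0"
    and rep: "\<And>f. f dvd h \<Longrightarrow> \<exists>F. F dvd pcompose A (monom 1 n) \<and> represents n s f F"
    unfolding h_def by (rule divisor_common_represents[OF ff s A]) blast
  define B where "B = pcompose A (monom 1 n)"
  have B0: "B \<noteq> 0" using deg_pos[OF n] unfolding B_def by auto
  obtain F where F: "\<And>f. f dvd h \<Longrightarrow> F f dvd B" "\<And>f. f dvd h \<Longrightarrow> represents n s f (F f)"
    using rep unfolding B_def by metis
  have F0: "F f \<noteq> 0" if "f dvd h" for f using F(1)[OF that] B0 by auto
  define m where "m f = smult (inverse (lead_coeff (F f))) (F f)" for f
  define cls where "cls f = {b. ring_assoc f b}" for f :: "'s \<Rightarrow>\<^sub>0 'k"
  have "m ` {f. f dvd h} \<subseteq> {F. F dvd B \<and> lead_coeff F = 1}"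
    using F(1) F0 by (auto simp: m_def smult_dvd_iff)
  then have fin_m: "finite (m ` {f. f dvd h})" using finite_monic_divisors[OF B0] finite_subset by blast
  have cls_eq: "cls f = cls g" if f: "f dvd h" and g: "g dvd h" and m: "m f = m g" for f g
  proof -
    let ?a = "lead_coeff (F f)" and ?b = "lead_coeff (F g)"
    have "F f = smult ?a (m f)" using F0[OF f] by (simp add: m_def)
    also have "\<dots> = smult (?a / ?b) (F g)" using m by (simp add: m_def divide_inverse)
    finally have "represents n s f (smult (?a / ?b) (F g))" using F(2)[OF f] by simp
    then have "f = g * Poly_Mapping.single 0 (?a / ?b)"
      by (rule represents_smult[OF _ F(2)[OF g] n])
    moreover have "?a / ?b \<noteq> 0" using F0 f g by simp
    ultimately show ?thesis unfolding cls_def by (rule ring_assoc_class_eqI[OF _ single_0_dvd_1])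
  qed
  \<comment> \<open>The class map factors through \<open>m\<close>: choose one divisor for each
    value of \<open>m\<close>.\<close>
  have "cls ` {f. f dvd h} \<subseteq> (\<lambda>p. cls (SOME f. f dvd h \<and> m f = p)) ` m ` {f. f dvd h}"
  proof
    fix c assume "c \<in> cls ` {f. f dvd h}"
    then obtain f where f: "f dvd h" "c = cls f" by blast
    define g where "g = (SOME g. g dvd h \<and> m g = m f)"
    have "g dvd h \<and> m g = m f" unfolding g_def by (rule someI[of _ f]) (use f in simp)
    then have "c = cls g" using cls_eq f by metis
    then show "c \<in> (\<lambda>p. cls (SOME f. f dvd h \<and> m f = p)) ` m ` {f. f dvd h}"
      using f(1) unfolding g_def by blast
  qed
  then have fin_cls: "finite (cls ` {f. f dvd h})" using fin_m finite_surj by blast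
  have "image_mset cls ` nonunit_factorizations h \<subseteq>
      {M. set_mset M \<subseteq> cls ` {f. f dvd h} \<and> size M \<le> degree B}"
  proof
    fix M' assume "M' \<in> image_mset cls ` nonunit_factorizations h"
    then obtain M where M: "M' = image_mset cls M" "prod_mset M = h" "\<And>a. a \<in># M \<Longrightarrow> \<not> a dvd 1"
      unfolding nonunit_factorizations_def by blast
    have dvd: "a dvd h" if "a \<in># M" for a using dvd_prod_mset[OF that] M(2) by simp
    \<comment> \<open>A factor represented by a constant is itself a nonzero constant, hence a
      unit.\<close>
    have pos: "degree (F a) > 0" if a: "a \<in># M" for a
    proof (rule ccontr)
      assume "\<not> degree (F a) > 0"
      then obtain c where c: "F a = [:c:]" using degree_eq_zeroE by auto
      then have "represents n s a (smult c 1)" using F(2)[OF dvd[OF a]] by (simp add: one_pCons)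
      then have "a = 1 * Poly_Mapping.single 0 c" by (rule represents_smult[OF _ represents_1 n])
      moreover have "c \<noteq> 0" using F0[OF dvd[OF a]] c by simp
      ultimately show False using M(3)[OF a] single_0_dvd_1 by (metis mult_1)
    qed
    \<comment> \<open>Representation is multiplicative and unique, so the chosen \<open>F a\<close>
      multiply exactly to \<open>B\<close>; each contributes at least 1 to its degree.\<close>
    have "represents n s h (\<Prod>a\<in>#M. F a)"
      using represents_prod_mset[of M n s F] F(2) dvd M(2) by blast
    then have "(\<Prod>a\<in>#M. F a) = B"
      by (rule represents_unique[OF _ _ s]) (simp add: B_def h_def represents_poly_subst_monomial)
    then have "size M \<le> degree B" using size_le_degree_prod_mset[of M F] pos by simp
    then show "M' \<in> {M. set_mset M \<subseteq> cls ` {f. f dvd h} \<and> size M \<le> degree B}"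
      using M(1) dvd by auto
  qed
  then have "finite (image_mset cls ` nonunit_factorizations h)"
    using finite_multisets_size_le[OF fin_cls] finite_subset by blast
  then show ?thesis using h0 h1 unfolding FF_property_def cls_def h_def by blast
qed

end

lemma degree_prod_cyclotomic_pos:
  assumes "P \<noteq> {#}" "\<And>p. p \<in># P \<Longrightarrow> cyclotomic_polynomial p"
  shows "degree (prod_mset P) > 0"
proof -
  have pos: "degree p > 0" if p: "p \<in># P" for p
  proof (rule ccontr)
    assume "\<not> degree p > 0"
    moreover have "lead_coeff p = 1" "\<not> p dvd 1"
      using assms(2)[OF p] irreducible_not_unit unfolding cyclotomic_polynomial_def by blast+
    ultimately show False by (auto elim!: degree_eq_zeroE simp: one_pCons)
  qed
  then have "size P \<le> degree (prod_mset P)" using size_le_degree_prod_mset[of P "\<lambda>p. p"] by simp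
  moreover have "size P > 0" using assms(1) by (simp add: nonempty_has_size)
  ultimately show ?thesis by linarith
qed

theorem theorem2p5:
  fixes s :: "'s::comm_monoid_add"
    and \<Phi> :: "'k::field_char_0 poly"
    and P :: "'k poly multiset"
  assumes "cancellative_monoid TYPE('s)"
    and "torsion_free_monoid TYPE('s)"
    and "reduced_monoid TYPE('s)"
    and "s \<noteq> 0"
    and "P \<noteq> {#}"
    and "\<forall>p\<in>#P. cyclotomic_polynomial p"
    and "\<Phi> = prod_mset P"
    and "finite_factorization_monoid TYPE('s)"
  shows "FF_property (poly_subst_monomial \<Phi> s :: 's \<Rightarrow>\<^sub>0 'k)"
proof -
  interpret reduced_torsion_free "TYPE('s)"
    by unfold_locales (fact assms)+
  show ?thesis
    using FF_property_roots_of_unity assms roots_of_unity_poly_prod degree_prod_cyclotomic_pos by metis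
qed

end
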